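(* Let $H_1$ be the Heisenberg group of $3\times3$ unipotent upper triangular matrices $\begin{pmatrix}1&x&z\\0&1&y\\0&0&1\end{pmatrix}$. (1) Let $k$ be a field of characteristic zero. Then every $n$-dimensional representation of $H_1$ over $k$ is given by a triple $X,Y,Z$ of $n\times n$ nilpotent matrices over $k$ satisfying $Z=[X,Y]$ and $[X,Z]=[Y,Z]=0$, according to the formula $$e^{xX+yY+(z-xy/2)Z}.$$ (2) Let $k$ be a field of positive characteristic $p$. Then if $p$ is sufficiently large with respect to $n$ (that is, $p\ge P(n)$ for some bound $P(n)$ depending only on $n$), every $n$-dimensional representation of $H_1$ over $k$ is given by a sequence $X_0,Y_0,Z_0,X_1,Y_1,Z_1,\ldots,X_m,Y_m,Z_m$ of $n\times n$ nilpotent matrices over $k$ satisfying $Z_i=[X_i,Y_i]$ and $[X_i,Z_i]=[Y_i,Z_i]=0$ for all $i$, and such that whenever $i\ne j$, $X_i,Y_i,Z_i$ all commute with $X_j,Y_j,Z_j$, according to the formula $$e^{xX_0+yY_0+(z-xy/2)Z_0}\,e^{x^pX_1+y^pY_1+(z^p-x^py^p/2)Z_1}\cdots e^{x^{p^m}X_m+y^{p^m}Y_m+(z^{p^m}-x^{p^m}y^{p^m}/2)Z_m}.$$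
   Context: The Hopf algebra of $H_1$ over $k$ is $k[x,y,z]$ with $\Delta(x)=1\otimes x+x\otimes1$, $\Delta(y)=1\otimes y+y\otimes1$, $\Delta(z)=1\otimes z+x\otimes y+z\otimes1$ and $\varepsilon(x)=\varepsilon(y)=\varepsilon(z)=0$. An $n$-dimensional representation is a comodule $\rho:V\to V\otimes k[x,y,z]$; given a basis $e_1,\dots,e_n$ of $V$ and $\rho(e_j)=\sum_ie_i\otimes a_{ij}$, its matrix formula is the matrix $(a_{ij})$ with entries in $k[x,y,z]$. "Given by the formula" means this matrix equals the stated expression. $[X,Y]=XY-YX$, and $e^N=\sum_{r\ge0}N^r/r!$ for nilpotent $N$, a finite sum. *)

theory Defs
  imports
    "Jordan_Normal_Form.Matrix"
    "HOL-Library.Poly_Mapping"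
    "HOL-Library.Product_Plus"
    "HOL-Computational_Algebra.Polynomial"
begin

section \<open>The Hopf algebra of the Heisenberg group\<close>

text \<open>
  The exponent triple \<open>(a, b, c)\<close> stands for the monomial \<open>x\<^sup>a y\<^sup>b z\<^sup>c\<close>, so that \<open>k[x,y,z]\<close>
  is the monoid algebra of the additive monoid of such triples. Accordingly
  \<open>k[x,y,z] \<otimes> k[x,y,z]\<close> is the monoid algebra of pairs of triples, the pair \<open>(p, q)\<close> standing for
  the tensor product of the monomials \<open>p\<close> and \<open>q\<close>; and, for a vector space \<open>V\<close>, the spaces
  \<open>V \<otimes> k[x,y,z]\<close> and \<open>V \<otimes> k[x,y,z] \<otimes> k[x,y,z]\<close> are the finitely supported functions from
  triples, respectively from pairs of triples, to \<open>V\<close>.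
\<close>

type_synonym mon = "nat \<times> nat \<times> nat"

type_synonym 'a coord_ring = "mon \<Rightarrow>\<^sub>0 'a"

type_synonym 'a coord_ring2 = "(mon \<times> mon) \<Rightarrow>\<^sub>0 'a"

definition const :: "'a \<Rightarrow> ('m::zero \<Rightarrow>\<^sub>0 'a::zero)" where
  "const c = Poly_Mapping.single 0 c"

definition xvar :: "'a::field coord_ring" where
  "xvar = Poly_Mapping.single (1, 0, 0) 1"

definition yvar :: "'a::field coord_ring" where
  "yvar = Poly_Mapping.single (0, 1, 0) 1"

definition zvar :: "'a::field coord_ring" where
  "zvar = Poly_Mapping.single (0, 0, 1) 1"

text \<open>The value at \<open>f\<close> of the algebra homomorphism that sends \<open>x, y, z\<close> to \<open>u, v, w\<close>, where
  \<open>\<iota>\<close> is the structure map of the target algebra.\<close>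

definition alg_eval ::
    "('a \<Rightarrow> 'b) \<Rightarrow> 'b \<Rightarrow> 'b \<Rightarrow> 'b \<Rightarrow> 'a::field coord_ring \<Rightarrow> 'b::comm_ring_1" where
  "alg_eval \<iota> u v w f =
     (\<Sum>(a, b, c)\<in>Poly_Mapping.keys f. \<iota> (Poly_Mapping.lookup f (a, b, c)) * u ^ a * v ^ b * w ^ c)"

definition ptensor :: "'a::field coord_ring \<Rightarrow> 'a coord_ring \<Rightarrow> 'a coord_ring2" where
  "ptensor f g =
     (\<Sum>p\<in>Poly_Mapping.keys f. \<Sum>q\<in>Poly_Mapping.keys g.
        Poly_Mapping.single (p, q) (Poly_Mapping.lookup f p * Poly_Mapping.lookup g q))"

definition comult :: "'a::field coord_ring \<Rightarrow> 'a coord_ring2" where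
  "comult = alg_eval const
     (ptensor 1 xvar + ptensor xvar 1)
     (ptensor 1 yvar + ptensor yvar 1)
     (ptensor 1 zvar + ptensor xvar yvar + ptensor zvar 1)"

definition counit :: "'a::field coord_ring \<Rightarrow> 'a" where
  "counit = alg_eval (\<lambda>c. c) 0 0 0"


section \<open>Representations and their matrix formulas\<close>

text \<open>The tensor \<open>v \<otimes> f\<close>, with \<open>f\<close> in \<open>k[x,y,z]\<close> or in \<open>k[x,y,z] \<otimes> k[x,y,z]\<close>.\<close>

definition vtensor ::
    "('a \<Rightarrow> 'v \<Rightarrow> 'v) \<Rightarrow> 'v \<Rightarrow> ('m \<Rightarrow>\<^sub>0 'a::field) \<Rightarrow> ('m \<Rightarrow>\<^sub>0 'v::ab_group_add)" where
  "vtensor scale v f =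
     (\<Sum>q\<in>Poly_Mapping.keys f. Poly_Mapping.single q (scale (Poly_Mapping.lookup f q) v))"

text \<open>The maps \<open>\<rho> \<otimes> id\<close>, \<open>id \<otimes> \<Delta>\<close> and \<open>id \<otimes> \<epsilon>\<close> on \<open>V \<otimes> k[x,y,z]\<close>.\<close>

definition coact_tensor_id ::
    "('v \<Rightarrow> (mon \<Rightarrow>\<^sub>0 'v)) \<Rightarrow> (mon \<Rightarrow>\<^sub>0 'v) \<Rightarrow> ((mon \<times> mon) \<Rightarrow>\<^sub>0 'v::ab_group_add)" where
  "coact_tensor_id \<rho> t =
     (\<Sum>q\<in>Poly_Mapping.keys t. \<Sum>p\<in>Poly_Mapping.keys (\<rho> (Poly_Mapping.lookup t q)).
        Poly_Mapping.single (p, q) (Poly_Mapping.lookup (\<rho> (Poly_Mapping.lookup t q)) p))"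

definition id_tensor_comult ::
    "('a::field \<Rightarrow> 'v \<Rightarrow> 'v) \<Rightarrow> (mon \<Rightarrow>\<^sub>0 'v) \<Rightarrow> ((mon \<times> mon) \<Rightarrow>\<^sub>0 'v::ab_group_add)" where
  "id_tensor_comult scale t =
     (\<Sum>q\<in>Poly_Mapping.keys t.
        vtensor scale (Poly_Mapping.lookup t q) (comult (Poly_Mapping.single q 1)))"

definition id_tensor_counit ::
    "('a::field \<Rightarrow> 'v \<Rightarrow> 'v) \<Rightarrow> (mon \<Rightarrow>\<^sub>0 'v) \<Rightarrow> 'v::ab_group_add" where
  "id_tensor_counit scale t =
     (\<Sum>q\<in>Poly_Mapping.keys t.
        scale (counit (Poly_Mapping.single q 1)) (Poly_Mapping.lookup t q))"

definition heisenberg_rep ::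
    "('a::field \<Rightarrow> 'v \<Rightarrow> 'v) \<Rightarrow> ('v \<Rightarrow> (mon \<Rightarrow>\<^sub>0 'v::ab_group_add)) \<Rightarrow> bool" where
  "heisenberg_rep scale \<rho> \<longleftrightarrow>
     Vector_Spaces.linear scale (\<lambda>c. Poly_Mapping.map (scale c)) \<rho> \<and>
     (\<forall>v. coact_tensor_id \<rho> (\<rho> v) = id_tensor_comult scale (\<rho> v)) \<and>
     (\<forall>v. id_tensor_counit scale (\<rho> v) = v)"

definition ordered_basis ::
    "('a::field \<Rightarrow> 'v \<Rightarrow> 'v::ab_group_add) \<Rightarrow> nat \<Rightarrow> (nat \<Rightarrow> 'v) \<Rightarrow> bool" where
  "ordered_basis scale n e \<longleftrightarrow>
     inj_on e {..<n} \<and>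
     \<not> module.dependent scale (e ` {..<n}) \<and>
     module.span scale (e ` {..<n}) = UNIV"

definition matrix_formula ::
    "('a::field \<Rightarrow> 'v \<Rightarrow> 'v) \<Rightarrow> nat \<Rightarrow> (nat \<Rightarrow> 'v) \<Rightarrow> ('v \<Rightarrow> (mon \<Rightarrow>\<^sub>0 'v::ab_group_add)) \<Rightarrow>
     'a coord_ring mat \<Rightarrow> bool" where
  "matrix_formula scale n e \<rho> A \<longleftrightarrow>
     A \<in> carrier_mat n n \<and>
     (\<forall>j<n. \<rho> (e j) = (\<Sum>i<n. vtensor scale (e i) (A $$ (i, j))))"


section \<open>Nilpotent matrices and the exponential formula\<close>

definition nilpotent_mat :: "nat \<Rightarrow> 'r::comm_ring_1 mat \<Rightarrow> bool" where
  "nilpotent_mat n N \<longleftrightarrow> N \<in> carrier_mat n n \<and> (\<exists>r. N ^\<^sub>m r = 0\<^sub>m n n)"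

definition commutator_mat :: "'r::comm_ring_1 mat \<Rightarrow> 'r mat \<Rightarrow> 'r mat" where
  "commutator_mat A B = A * B - B * A"

text \<open>Meaningful when \<open>N\<close> is nilpotent and \<open>r!\<close> is invertible in the field whenever \<open>N\<^sup>r \<noteq> 0\<close>.
  In positive characteristic \<open>p\<close> the latter holds if \<open>p \<ge> n\<close>, as then \<open>N\<^sup>p = 0\<close>.\<close>

definition mat_exp :: "nat \<Rightarrow> 'a::field coord_ring mat \<Rightarrow> 'a coord_ring mat" where
  "mat_exp n N = mat n n (\<lambda>(i, j).
     \<Sum>r | N ^\<^sub>m r \<noteq> 0\<^sub>m n n. const (1 / of_nat (fact r)) * (N ^\<^sub>m r) $$ (i, j))"

text \<open>The matrix \<open>e\<^bsup>uX + vY + (w - uv/2)Z\<^esup>\<close>.\<close>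

definition heisenberg_exp ::
    "nat \<Rightarrow> 'a::field coord_ring \<Rightarrow> 'a coord_ring \<Rightarrow> 'a coord_ring \<Rightarrow>
     'a mat \<Rightarrow> 'a mat \<Rightarrow> 'a mat \<Rightarrow> 'a coord_ring mat" where
  "heisenberg_exp n u v w X Y Z =
     mat_exp n (u \<cdot>\<^sub>m map_mat const X + v \<cdot>\<^sub>m map_mat const Y
                + (w - const (1 / 2) * (u * v)) \<cdot>\<^sub>m map_mat const Z)"

text \<open>The product \<open>F 0 * F 1 * \<dots> * F m\<close>, in this order.\<close>

definition ordered_prod_mat :: "nat \<Rightarrow> nat \<Rightarrow> (nat \<Rightarrow> 'r::comm_ring_1 mat) \<Rightarrow> 'r mat" where
  "ordered_prod_mat n m F = foldr (\<lambda>i B. F i * B) [0..<Suc m] (1\<^sub>m n)"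

definition heisenberg_triple :: "nat \<Rightarrow> 'a::field mat \<Rightarrow> 'a mat \<Rightarrow> 'a mat \<Rightarrow> bool" where
  "heisenberg_triple n X Y Z \<longleftrightarrow>
     nilpotent_mat n X \<and> nilpotent_mat n Y \<and> nilpotent_mat n Z \<and>
     Z = commutator_mat X Y \<and>
     commutator_mat X Z = 0\<^sub>m n n \<and> commutator_mat Y Z = 0\<^sub>m n n"


section \<open>The bound on the characteristic\<close>

text \<open>
  A bound that depends on \<open>n\<close> alone has to be the same for all fields \<open>k\<close>. Here \<open>k\<close> is a type, and
  an existential quantifier over bounds inside a theorem would be read separately for each such type
  (where any bound exceeding \<open>CHAR('a)\<close> would do). The bound is therefore a monomorphic
  constant. For \<open>n \<ge> 1\<close> it makes \<open>p\<close> odd and greater than \<open>n\<close>, so that the exponentials and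
  the division by 2 are meaningful.
\<close>

definition char_bound :: "nat \<Rightarrow> nat" where
  "char_bound n = 4 * n"

end

theory Submission
  imports
    Defs
    "HOL-Computational_Algebra.Formal_Power_Series"
    "Jordan_Normal_Form.Determinant"
begin

text \<open>
  Write the matrix formula as \<open>\<Sum> x\<^sup>a y\<^sup>b z\<^sup>c A\<^bsub>abc\<^esub>\<close>. The comodule axioms say that
  the \<open>A\<^bsub>abc\<^esub>\<close> multiply like the basis dual to the monomials, so \<open>A\<^bsub>abc\<^esub> = Y\<^bsub>b\<^esub> X\<^bsub>a\<^esub> Z\<^bsub>c\<^esub>\<close>
  with \<open>X\<^bsub>a\<^esub> = A\<^bsub>a00\<^esub>\<close> etc., where each of the three sequences consists of divided powers, the
  \<open>Z\<^bsub>c\<^esub>\<close> are central and \<open>X\<^bsub>i\<^esub> Y\<^bsub>j\<^esub> = \<Sum>\<^sub>t Y\<^bsub>j-t\<^esub> X\<^bsub>i-t\<^esub> Z\<^bsub>t\<^esub>\<close>. In characteristic zero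
  \<open>X\<^bsub>a\<^esub> = X\<^sup>a/a!\<close>, and the formula is \<open>e\<^bsup>yY\<^esup> e\<^bsup>xX\<^esup> e\<^bsup>zZ\<^esup>\<close>, which equals the single exponential by
  the Baker--Campbell--Hausdorff identity for a central commutator.

  In characteristic \<open>p\<close> the same holds for the truncated exponentials: all degrees that occur are at
  most \<open>4n - 4\<close>, because \<open>X\<^sup>n = Y\<^sup>n = Z\<^sup>n = 0\<close>. By Lucas' theorem, \<open>X\<^bsub>pa+d\<^esub> = X\<^bsub>pa\<^esub> X\<^sup>d/d!\<close> for \<open>d < p\<close>,
  and this vanishes for \<open>d \<ge> n\<close>. If \<open>0 < d < p\<close> then one of \<open>d\<close>, \<open>p - d\<close> is at least \<open>n\<close>; hence the
  sequences \<open>X\<^bsub>pa\<^esub>\<close>, \<open>Y\<^bsub>pb\<^esub>\<close>, \<open>Z\<^bsub>pc\<^esub>\<close> satisfy the same relations again and commute with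
  \<open>X\<^bsub>1\<^esub>\<close>, \<open>Y\<^bsub>1\<^esub>\<close>, \<open>Z\<^bsub>1\<^esub>\<close>. Peeling off one exponential factor at a time gives the product formula.
\<close>

section \<open>Nilpotent matrices\<close>

text \<open>Suppose the least \<open>m\<close> with \<open>X^m = 0\<close> exceeded
  \<open>n\<close>, and take a nonzero entry \<open>(i, j)\<close> of \<open>X^(m-1)\<close>. The
  \<open>n + 1\<close> columns \<open>X^k e_j\<close> with \<open>k \<le> n\<close> are dependent,
  and a suitable power of \<open>X\<close> reduces a relation between them to its lowest term, a
  nonzero multiple of \<open>X^(m-1) e_j\<close>.\<close>

lemma nilpotent_mat_power_dim:
  fixes X :: "'a::field mat"
  assumes X: "X \<in> carrier_mat n n" and r: "X ^\<^sub>m r = 0\<^sub>m n n"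
  shows "X ^\<^sub>m n = 0\<^sub>m n n"
proof -
  define m where "m = (LEAST m. X ^\<^sub>m m = 0\<^sub>m n n)"
  have pow: "X ^\<^sub>m k \<in> carrier_mat n n" for k using X by simp
  have pow_add: "X ^\<^sub>m (k + l) = X ^\<^sub>m k * X ^\<^sub>m l" for k l
    by (induction l) (use X in \<open>simp_all add: assoc_mult_mat[of _ n n _ n _ n]\<close>)
  have m: "X ^\<^sub>m m = 0\<^sub>m n n" unfolding m_def by (rule LeastI[of _ r]) (rule r)
  have ge: "X ^\<^sub>m k = 0\<^sub>m n n" if "k \<ge> m" for k
    using pow_add[of m "k - m"] m that left_mult_zero_mat[OF pow] by simp
  have least: "X ^\<^sub>m k \<noteq> 0\<^sub>m n n" if "k < m" for k
    using not_less_Least[of k "\<lambda>m. X ^\<^sub>m m = 0\<^sub>m n n"] that by (simp add: m_def)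
  have "m \<le> n"
  proof (rule ccontr)
    assume "\<not> m \<le> n"
    then have nm: "n < m" by simp
    have "X ^\<^sub>m (m - 1) \<noteq> 0\<^sub>m n n" using nm by (intro least) simp
    then obtain i j where ij: "i < n" "j < n" "(X ^\<^sub>m (m - 1)) $$ (i, j) \<noteq> 0"
      using pow[of "m - 1"] by (metis carrier_matD index_zero_mat eq_matI)
    \<comment> \<open>Column \<open>k\<close> of \<open>M\<close> is column \<open>j\<close> of
      \<open>X^k\<close>. The added zero row makes \<open>M\<close> square and singular, so its
      kernel contains the coefficients \<open>c\<close> of a nontrivial relation.\<close>
    define M where "M = mat\<^sub>r (Suc n) (Suc n) (\<lambda>r. if r = n then 0\<^sub>v (Suc n)
      else vec (Suc n) (\<lambda>k. (X ^\<^sub>m k) $$ (r, j)))"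
    have M: "M \<in> carrier_mat (Suc n) (Suc n)" by (simp add: M_def)
    have "det M = 0" unfolding M_def by (rule det_row_0) auto
    then obtain c where c: "c \<in> carrier_vec (Suc n)" "c \<noteq> 0\<^sub>v (Suc n)" "M *\<^sub>v c = 0\<^sub>v (Suc n)"
      using det_0_iff_vec_prod_zero_field[OF M] by auto
    have lin: "(\<Sum>k<Suc n. (X ^\<^sub>m k) $$ (r, j) * c $ k) = 0" if "r < n" for r
    proof -
      have "(M *\<^sub>v c) $ r = 0" using c(3) that by simp
      then show ?thesis using that c(1) M
        by (simp add: scalar_prod_def M_def atLeast0LessThan del: sum.lessThan_Suc)
    qed
    define d where "d = (LEAST k. k < Suc n \<and> c $ k \<noteq> 0)"
    have "\<exists>k. k < Suc n \<and> c $ k \<noteq> 0"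
      using c(1,2) by (metis carrier_vecD eq_vecI index_zero_vec)
    then have d: "d < Suc n" "c $ d \<noteq> 0"
      unfolding d_def by (metis (mono_tags, lifting) LeastI_ex)+
    have below: "c $ k = 0" if "k < d" for k
      using not_less_Least[of k "\<lambda>k. k < Suc n \<and> c $ k \<noteq> 0"] that d(1) by (simp add: d_def)
    \<comment> \<open>As \<open>d \<le> n < m\<close>, the subtraction does not truncate:
      \<open>X^s\<close> turns the term of index \<open>d\<close> into \<open>X^(m-1)\<close> and
      kills the terms of higher index.\<close>
    define s where "s = m - 1 - d"
    have "0 = (\<Sum>r<n. (X ^\<^sub>m s) $$ (i, r) * (\<Sum>k<Suc n. (X ^\<^sub>m k) $$ (r, j) * c $ k))"
      by (simp add: lin del: sum.lessThan_Suc)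
    also have "\<dots> = (\<Sum>k<Suc n. (\<Sum>r<n. (X ^\<^sub>m s) $$ (i, r) * (X ^\<^sub>m k) $$ (r, j)) * c $ k)"
      unfolding sum_distrib_left sum_distrib_right mult.assoc by (rule sum.swap)
    also have "\<dots> = (\<Sum>k<Suc n. (X ^\<^sub>m (s + k)) $$ (i, j) * c $ k)"
      using ij carrier_matD[OF pow] by (intro sum.cong refl) (simp add: pow_add scalar_prod_def atLeast0LessThan)
    also have "\<dots> = (\<Sum>k\<in>{d}. (X ^\<^sub>m (s + k)) $$ (i, j) * c $ k)"
    proof (rule sum.mono_neutral_right)
      show "\<forall>k\<in>{..<Suc n} - {d}. (X ^\<^sub>m (s + k)) $$ (i, j) * c $ k = 0"
      proof
        fix k assume "k \<in> {..<Suc n} - {d}"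
        then have "k < d \<or> s + k \<ge> m" using nm d(1) by (auto simp: s_def)
        then consider "k < d" | "s + k \<ge> m" by blast
        then show "(X ^\<^sub>m (s + k)) $$ (i, j) * c $ k = 0"
          by cases (use below ge ij in auto)
      qed
    qed (use d in auto)
    also have "\<dots> \<noteq> 0" using d ij nm by (simp add: s_def)
    finally show False by simp
  qed
  then show ?thesis by (rule ge)
qed

section \<open>Exponentials with a central commutator\<close>

no_notation vec_index (infixl "$" 100)
unbundle fps_syntax

section \<open>Power series with finitely many nonzero coefficients\<close>

lemma fps_mult_eventually_zero:
  fixes f g :: "'r::ring_1 fps"
  assumes f: "\<And>i. i \<ge> A \<Longrightarrow> f $ i = 0" and g: "\<And>i. i \<ge> B \<Longrightarrow> g $ i = 0" and i: "i \<ge> A + B"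
  shows "(f * g) $ i = 0"
  unfolding fps_mult_nth
proof (rule sum.neutral, rule ballI)
  fix j assume "j \<in> {0..i}"
  then have "j \<ge> A \<or> i - j \<ge> B" using i by auto
  then show "f $ j * g $ (i - j) = 0" using f g by auto
qed

text \<open>Summing all coefficients is evaluation at 1, which is multiplicative;
  \<open>L \<ge> A + B\<close> ensures that the cutoff loses no nonzero product.\<close>

lemma fps_mult_sum_coeffs:
  fixes f g :: "'r::ring_1 fps"
  assumes f: "\<And>i. i \<ge> A \<Longrightarrow> f $ i = 0" and g: "\<And>i. i \<ge> B \<Longrightarrow> g $ i = 0" and L: "L \<ge> A + B"
  shows "(\<Sum>i<L. (f * g) $ i) = (\<Sum>i<A. f $ i) * (\<Sum>i<B. g $ i)"
proof -
  let ?S = "SIGMA i:{..<L}. {0..i}"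
  have "(\<Sum>i<L. (f * g) $ i) = (\<Sum>(i, j)\<in>?S. f $ j * g $ (i - j))"
    by (simp add: fps_mult_nth sum.Sigma)
  also have "\<dots> = (\<Sum>(j, k)\<in>{(j, k). j + k < L}. f $ j * g $ k)"
    by (rule sum.reindex_bij_witness[of _ "\<lambda>(j, k). (j + k, j)" "\<lambda>(i, j). (j, i - j)"]) auto
  also have "\<dots> = (\<Sum>(j, k)\<in>{..<A} \<times> {..<B}. f $ j * g $ k)"
  proof (rule sum.mono_neutral_right)
    show "finite {(j, k). j + k < L}"
      by (rule finite_subset[of _ "{..<L} \<times> {..<L}"]) auto
    show "{..<A} \<times> {..<B} \<subseteq> {(j, k). j + k < L}" using L by auto
    show "\<forall>i\<in>{(j, k). j + k < L} - {..<A} \<times> {..<B}. (case i of (j, k) \<Rightarrow> f $ j * g $ k) = 0"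
      using f g by (auto simp: not_less) (metis mult_zero_left mult_zero_right not_le)+
  qed
  also have "\<dots> = (\<Sum>i<A. f $ i) * (\<Sum>i<B. g $ i)"
    by (simp add: sum_product sum.cartesian_product)
  finally show ?thesis .
qed

text \<open>In degree \<open>r\<close> the equation \<open>G' = N G\<close> reads
  \<open>(r+1) G_(r+1) = N G_r\<close>. Keeping the factorial on the left avoids division, so no
  condition on the characteristic is imposed.\<close>

lemma fps_deriv_eq_const_mult_power:
  fixes G :: "'r::ring_1 fps"
  assumes "fps_deriv G = fps_const N * G" "G $ 0 = 1"
  shows "of_nat (fact r) * G $ r = N ^ r"
proof (induction r)
  case (Suc r)
  have "of_nat (Suc r) * G $ Suc r = N * G $ r"
    using arg_cong[OF assms(1), of "\<lambda>f. f $ r"] by simp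
  moreover have "(of_nat (fact (Suc r)) :: 'r) = of_nat (fact r) * of_nat (Suc r)"
    by (metis fact_Suc mult.commute of_nat_id of_nat_mult)
  ultimately have "of_nat (fact (Suc r)) * G $ Suc r = of_nat (fact r) * (N * G $ r)"
    by (simp only: mult.assoc)
  also have "\<dots> = N * (of_nat (fact r) * G $ r)"
    by (metis mult.assoc mult_of_nat_commute)
  finally show ?case using Suc by simp
qed (use assms in simp)

text \<open>Only the factorials below \<open>q\<close> are assumed invertible. This treats
  characteristic zero, where \<open>q\<close> can be as large as desired, and characteristic
  \<open>p\<close>, where \<open>q = p\<close>, at the same time.\<close>

locale exp_scalars =
  fixes \<sigma> :: "'c::comm_ring_1 \<Rightarrow> 'r::ring_1" and \<phi> :: "nat \<Rightarrow> 'c" and q :: nat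
  assumes scalar_add: "\<sigma> (a + b) = \<sigma> a + \<sigma> b"
    and scalar_mult: "\<sigma> (a * b) = \<sigma> a * \<sigma> b"
    and scalar_1: "\<sigma> 1 = 1"
    and scalar_central: "\<sigma> a * r = r * \<sigma> a"
    and inverse_fact: "k < q \<Longrightarrow> \<phi> k * of_nat (fact k) = 1"
begin

lemma scalar_0: "\<sigma> 0 = 0"
  using scalar_add[of 0 0] by simp

lemma scalar_of_nat: "\<sigma> (of_nat k) = of_nat k"
  by (induction k) (simp_all add: scalar_0 scalar_1 scalar_add)

lemma scalar_left_commute: "r * (\<sigma> a * s) = \<sigma> a * (r * s)"
  by (metis mult.assoc scalar_central)

lemma fact_cancel:
  fixes r s :: 'r
  assumes "k < q" and "of_nat (fact k) * r = of_nat (fact k) * s"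
  shows "r = s"
proof -
  have inv: "\<sigma> (\<phi> k) * of_nat (fact k) = 1"
    unfolding scalar_of_nat[symmetric] scalar_mult[symmetric] inverse_fact[OF assms(1)]
    by (rule scalar_1)
  have "\<sigma> (\<phi> k) * of_nat (fact k) * r = \<sigma> (\<phi> k) * of_nat (fact k) * s"
    unfolding mult.assoc assms(2) ..
  then show ?thesis unfolding inv by simp
qed

lemma inverse_fact_Suc: "Suc k < q \<Longrightarrow> \<phi> k = of_nat (Suc k) * \<phi> (Suc k)"
proof -
  assume k: "Suc k < q"
  have "\<phi> k = \<phi> k * (\<phi> (Suc k) * of_nat (fact (Suc k)))"
    using inverse_fact[OF k] by simp
  also have "\<dots> = (\<phi> k * of_nat (fact k)) * (of_nat (Suc k) * \<phi> (Suc k))"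
    by (simp add: algebra_simps)
  finally show ?thesis using inverse_fact[of k] k by simp
qed

text \<open>This stands for \<open>N^k / k!\<close>. For \<open>k \<ge> q\<close> the factor
  \<open>\<phi> k\<close> is unconstrained; the lemmas on exponentials therefore assume a power of
  \<open>N\<close> below \<open>q\<close> to vanish, so that such terms are 0.\<close>

definition divided_power :: "'r \<Rightarrow> nat \<Rightarrow> 'r" where
  "divided_power N k = \<sigma> (\<phi> k) * N ^ k"

lemma divided_power_0 [simp]: "q > 0 \<Longrightarrow> divided_power N 0 = 1"
  using inverse_fact[of 0] by (simp add: divided_power_def scalar_1)

lemma divided_power_Suc:
  assumes "Suc k < q"
  shows "of_nat (Suc k) * divided_power N (Suc k) = N * divided_power N k"
proof -
  have "N * divided_power N k = \<sigma> (\<phi> k) * (N * N ^ k)"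
    unfolding divided_power_def by (rule scalar_left_commute)
  also have "\<dots> = of_nat (Suc k) * divided_power N (Suc k)"
    unfolding divided_power_def inverse_fact_Suc[OF assms] scalar_mult scalar_of_nat
    by (simp only: mult.assoc power_Suc)
  finally show ?thesis ..
qed

lemma divided_powerI:
  assumes "k < q" "of_nat (fact k) * r = N ^ k"
  shows "r = divided_power N k"
proof (rule fact_cancel[OF assms(1)])
  have "of_nat (fact k) * divided_power N k = \<sigma> (\<phi> k * of_nat (fact k)) * N ^ k"
    unfolding scalar_mult scalar_of_nat divided_power_def
    by (metis mult.assoc scalar_central)
  then show "of_nat (fact k) * r = of_nat (fact k) * divided_power N k"
    using assms inverse_fact scalar_1 by simp
qed

lemma divided_power_eq_0:
  assumes "N ^ m = 0" "k \<ge> m"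
  shows "divided_power N k = 0"
proof -
  have "N ^ k = N ^ m * N ^ (k - m)" using assms(2) by (simp flip: power_add)
  then show ?thesis using assms(1) by (simp add: divided_power_def)
qed

lemma divided_power_scaled: "divided_power (\<sigma> u * N) k = \<sigma> (u ^ k) * divided_power N k"
proof -
  have "(\<sigma> u * N) ^ k = \<sigma> (u ^ k) * N ^ k"
    by (induction k) (simp_all add: scalar_1 scalar_mult scalar_left_commute[of N] mult.assoc)
  then show ?thesis unfolding divided_power_def by (simp only:) (rule scalar_left_commute)
qed

lemma divided_power_commute: "N * M = M * N \<Longrightarrow> divided_power N k * M = M * divided_power N k"
  unfolding divided_power_def scalar_left_commute[of M] mult.assoc
  by (simp only: power_commuting_commutes)

definition exp_fps :: "'r \<Rightarrow> 'r fps" where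
  "exp_fps N = Abs_fps (divided_power N)"

lemma exp_fps_nth [simp]: "exp_fps N $ k = divided_power N k"
  by (simp add: exp_fps_def)

text \<open>Below degree \<open>q - 1\<close> this is the recursion of divided powers. From there on
  both sides vanish because \<open>m < q\<close>, so the truncated exponential solves the
  differential equation exactly.\<close>

lemma exp_fps_deriv:
  assumes "N ^ m = 0" "m < q"
  shows "fps_deriv (exp_fps N) = fps_const N * exp_fps N"
proof (rule fps_ext)
  fix k
  show "fps_deriv (exp_fps N) $ k = (fps_const N * exp_fps N) $ k"
  proof (cases "Suc k < q")
    case True
    then show ?thesis using divided_power_Suc[of k N] by simp
  next
    case False
    then have "k \<ge> m" using assms by auto
    then show ?thesis using divided_power_eq_0[OF assms(1)] by simp
  qed
qed

lemma exp_fps_commute: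
  assumes "N * M = M * N"
  shows "exp_fps N * fps_const M = fps_const M * exp_fps N"
  by (rule fps_ext) (simp add: divided_power_commute[OF assms])

text \<open>Since \<open>C\<close> commutes with \<open>V\<close>, moving \<open>U\<close> through
  \<open>V^(j+1)\<close> leaves \<open>(j+1) C V^j\<close>. Dividing by \<open>(j+1)!\<close> gives
  \<open>U e^(\<tau>V) = e^(\<tau>V) U + \<tau> C e^(\<tau>V)\<close>, coefficient by
  coefficient.\<close>

lemma exp_fps_commutator:
  assumes UV: "U * V = V * U + C" and CV: "C * V = V * C" and V: "V ^ m = 0" "m < q"
  shows "fps_const U * exp_fps V = exp_fps V * fps_const U + fps_X * fps_const C * exp_fps V"
proof (rule fps_ext)
  fix k
  have pow: "U * V ^ Suc j = V ^ Suc j * U + of_nat (Suc j) * (C * V ^ j)" for j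
  proof (induction j)
    case (Suc j)
    have CVj: "C * V ^ i = V ^ i * C" for i by (metis CV power_commuting_commutes)
    have "U * V ^ Suc (Suc j) = (U * V ^ Suc j) * V"
      by (metis mult.assoc power_Suc2)
    also have "\<dots> = V ^ Suc j * (U * V) + of_nat (Suc j) * (C * V ^ Suc j)"
      unfolding Suc by (simp only: distrib_right mult.assoc power_Suc2)
    also have "\<dots> = V ^ Suc (Suc j) * U + V ^ Suc j * C + of_nat (Suc j) * (C * V ^ Suc j)"
      unfolding UV by (simp only: distrib_left mult.assoc power_Suc2)
    also have "\<dots> = V ^ Suc (Suc j) * U + of_nat (Suc (Suc j)) * (C * V ^ Suc j)"
      unfolding CVj[symmetric] by (simp add: algebra_simps)
    finally show ?case .
  qed (simp add: UV)
  show "(fps_const U * exp_fps V) $ k =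
      (exp_fps V * fps_const U + fps_X * fps_const C * exp_fps V) $ k"
  proof (cases k)
    case 0
    then show ?thesis using V(2) by (simp add: mult.assoc)
  next
    case (Suc j)
    have "U * divided_power V (Suc j) = divided_power V (Suc j) * U + C * divided_power V j"
    proof (cases "Suc j < q")
      case True
      have "U * divided_power V (Suc j) = \<sigma> (\<phi> (Suc j)) * (U * V ^ Suc j)"
        unfolding divided_power_def by (rule scalar_left_commute)
      also have "\<dots> = divided_power V (Suc j) * U + \<sigma> (\<phi> (Suc j)) * (of_nat (Suc j) * (C * V ^ j))"
        unfolding pow divided_power_def by (simp only: distrib_left mult.assoc)
      also have "\<sigma> (\<phi> (Suc j)) * (of_nat (Suc j) * (C * V ^ j)) = C * divided_power V j"
      proof -
        have "C * divided_power V j = \<sigma> (\<phi> j) * (C * V ^ j)"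
          unfolding divided_power_def by (rule scalar_left_commute)
        also have "\<dots> = of_nat (Suc j) * \<sigma> (\<phi> (Suc j)) * (C * V ^ j)"
          unfolding inverse_fact_Suc[OF True] scalar_mult scalar_of_nat ..
        also have "\<dots> = \<sigma> (\<phi> (Suc j)) * (of_nat (Suc j) * (C * V ^ j))"
          unfolding mult_of_nat_commute mult.assoc ..
        finally show ?thesis ..
      qed
      finally show ?thesis .
    next
      case False
      \<comment> \<open>Beyond the invertible factorials \<open>j + 1 \<ge> q > m\<close>, so every
        divided power of \<open>V\<close> in the equation is 0.\<close>
      then have "j \<ge> m" using V(2) by auto
      then show ?thesis using divided_power_eq_0[OF V(1)] by simp
    qed
    then show ?thesis using Suc by (simp add: mult.assoc)
  qed
qed

text \<open>The series \<open>e^(\<tau>\<tau>W)\<close>. Its logarithmic derivative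
  \<open>2 \<tau> W\<close> is linear in \<open>\<tau>\<close>, which is what is needed to cancel a
  commutator term.\<close>

definition exp_sq_fps :: "'r \<Rightarrow> 'r fps" where
  "exp_sq_fps W = Abs_fps (\<lambda>k. if even k then divided_power W (k div 2) else 0)"

lemma exp_sq_fps_nth [simp]:
  "exp_sq_fps W $ k = (if even k then divided_power W (k div 2) else 0)"
  by (simp add: exp_sq_fps_def)

lemma exp_sq_fps_commute:
  assumes "N * M = M * N"
  shows "exp_sq_fps N * fps_const M = fps_const M * exp_sq_fps N"
  by (rule fps_ext) (simp add: divided_power_commute[OF assms])

lemma exp_sq_fps_deriv:
  assumes "W ^ m = 0" "m < q"
  shows "fps_deriv (exp_sq_fps W) = fps_X * fps_const (2 * W) * exp_sq_fps W"
proof (rule fps_ext)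
  fix k :: nat
  \<comment> \<open>Only odd degrees \<open>2c + 1\<close> contribute; in degree 0 and in positive
    even degrees both sides are 0.\<close>
  consider "k = 0" | c where "k = 2 * c + 1" | c where "k = 2 * c + 2"
  proof -
    have "k = 0 \<or> (\<exists>c. k = 2 * c + 1) \<or> (\<exists>c. k = 2 * c + 2)" by presburger
    then show ?thesis using that by blast
  qed
  then show "fps_deriv (exp_sq_fps W) $ k = (fps_X * fps_const (2 * W) * exp_sq_fps W) $ k"
  proof cases
    case 2
    have "of_nat (Suc c) * divided_power W (Suc c) = W * divided_power W c"
    proof (cases "Suc c < q")
      case True
      then show ?thesis using divided_power_Suc by blast
    next
      case False
      then have "c \<ge> m" using assms(2) by auto
      then show ?thesis using divided_power_eq_0[OF assms(1)] by simp
    qed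
    then have "2 * (of_nat (Suc c) * divided_power W (Suc c)) = 2 * (W * divided_power W c)"
      by simp
    moreover have "of_nat (2 * c + 2) = (2 * of_nat (Suc c) :: 'r)" by simp
    ultimately have "of_nat (2 * c + 2) * divided_power W (Suc c) = 2 * W * divided_power W c"
      by (metis mult.assoc)
    then show ?thesis using 2 by (simp add: mult.assoc)
  qed (simp_all add: mult.assoc)
qed

text \<open>The product of the two exponentials satisfies \<open>G' = (W + T) G\<close>. The joint
  vanishing condition, stronger than nilpotency of \<open>W\<close> and \<open>T\<close> separately,
  makes \<open>G\<close> vanish already from degree \<open>m\<close> on, so that all three sums can
  stop at \<open>m\<close>.\<close>

lemma divided_power_sum_commuting:
  assumes WT: "W * T = T * W" and van: "\<And>c d. c + d \<ge> m \<Longrightarrow> W ^ c * T ^ d = 0" and m: "m < q"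
  shows "(\<Sum>k<m. divided_power (W + T) k) = (\<Sum>k<m. divided_power W k) * (\<Sum>k<m. divided_power T k)"
proof -
  have W: "W ^ m = 0" and T: "T ^ m = 0" using van[of m 0] van[of 0 m] by simp_all
  let ?G = "exp_fps W * exp_fps T"
  have "fps_deriv ?G = fps_const (W + T) * ?G"
  proof -
    have "fps_deriv ?G = exp_fps W * fps_const T * exp_fps T + fps_const W * ?G"
      using exp_fps_deriv[OF W m] exp_fps_deriv[OF T m] by (simp add: mult.assoc)
    also have "exp_fps W * fps_const T = fps_const T * exp_fps W"
      using WT by (rule exp_fps_commute)
    also have "fps_const T * exp_fps W * exp_fps T + fps_const W * ?G = fps_const (W + T) * ?G"
      by (simp add: mult.assoc distrib_right flip: fps_const_add)
    finally show ?thesis .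
  qed
  then have G: "of_nat (fact k) * ?G $ k = (W + T) ^ k" for k
    by (rule fps_deriv_eq_const_mult_power) (use m in simp)
  have van': "?G $ k = 0" if "k \<ge> m" for k
    unfolding fps_mult_nth
  proof (rule sum.neutral, rule ballI)
    fix j assume "j \<in> {0..k}"
    then have "W ^ j * T ^ (k - j) = 0" using van that by auto
    then show "exp_fps W $ j * exp_fps T $ (k - j) = 0"
      by (simp add: divided_power_def mult.assoc scalar_left_commute[of "W ^ _"])
  qed
  have "(\<Sum>k<m. divided_power (W + T) k) = (\<Sum>k<m. ?G $ k)"
    by (rule sum.cong[OF refl]) (use G m in \<open>auto intro!: divided_powerI[symmetric]\<close>)
  also have "\<dots> = (\<Sum>k<m + m. ?G $ k)"
    by (rule sum.mono_neutral_left) (auto simp: van')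
  also have "\<dots> = (\<Sum>k<m. exp_fps W $ k) * (\<Sum>k<m. exp_fps T $ k)"
    by (rule fps_mult_sum_coeffs) (auto intro: divided_power_eq_0[OF W] divided_power_eq_0[OF T])
  finally show ?thesis by simp
qed

text \<open>The series \<open>G(\<tau>) = e\<^bsup>\<tau>V\<^esup> e\<^bsup>\<tau>U\<^esup> e\<^bsup>\<tau>\<tau>W\<^esup> e\<^bsup>\<tau>T\<^esup>\<close> satisfies \<open>G' = (U + V + T) G\<close>, even with truncated
  exponentials, as the four elements are nilpotent of order less than \<open>q\<close>. So its coefficients are
  the divided powers of \<open>U + V + T\<close>, and they vanish from degree \<open>4m\<close> on.\<close>

lemma exp_commutator_sum:
  assumes UV: "U * V = V * U + 2 * W"
    and comm: "U * W = W * U" "V * W = W * V" "U * T = T * U" "V * T = T * V" "W * T = T * W"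
    and V: "V ^ m = 0" and U: "U ^ m = 0"
    and van: "\<And>c d. c + d \<ge> m \<Longrightarrow> W ^ c * T ^ d = 0" and m: "4 * m \<le> q" "m > 0"
  shows "k \<ge> 4 * m \<Longrightarrow> (U + V + T) ^ k = 0"
    and "(\<Sum>k<4 * m. divided_power (U + V + T) k) =
      (\<Sum>k<m. divided_power V k) * (\<Sum>k<m. divided_power U k) * (\<Sum>k<m. divided_power (W + T) k)"
proof -
  have mq: "m < q" using m by simp
  have W: "W ^ m = 0" and T: "T ^ m = 0" using van[of m 0] van[of 0 m] by simp_all
  define v where "v = exp_fps V"
  define u where "u = exp_fps U"
  define w where "w = exp_sq_fps W"
  define t where "t = exp_fps T"
  \<comment> \<open>\<open>C\<close> is both the logarithmic derivative of \<open>w\<close> and the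
    factor that measures how \<open>U\<close> fails to commute with \<open>v\<close>.\<close>
  define C where "C = fps_X * fps_const (2 * W)"
  let ?G = "v * u * w * t"
  have nth: "v $ i = divided_power V i" "u $ i = divided_power U i" "t $ i = divided_power T i" for i
    by (simp_all add: v_def u_def t_def)
  have dv: "fps_deriv v = fps_const V * v" "fps_deriv u = fps_const U * u"
      "fps_deriv w = C * w" "fps_deriv t = fps_const T * t"
    unfolding v_def u_def w_def t_def C_def
    by (rule exp_fps_deriv[OF V mq] exp_fps_deriv[OF U mq] exp_sq_fps_deriv[OF W mq] exp_fps_deriv[OF T mq])+
  have c2: "V * (2 * W) = 2 * W * V" "U * (2 * W) = 2 * W * U"
    using comm by (simp_all add: mult_2 mult_2_right algebra_simps)
  have Cv: "v * C = C * v" "u * C = C * u"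
    unfolding C_def v_def u_def
    by (metis (no_types) mult.assoc fps_mult_fps_X_commute exp_fps_commute c2)+
  have Tv: "v * fps_const T = fps_const T * v" "u * fps_const T = fps_const T * u"
      "w * fps_const T = fps_const T * w"
    unfolding v_def u_def w_def using comm by (auto intro: exp_fps_commute exp_sq_fps_commute)
  have Tv': "v * (fps_const T * f) = fps_const T * (v * f)" "u * (fps_const T * f) = fps_const T * (u * f)"
      "w * (fps_const T * f) = fps_const T * (w * f)" for f
    using Tv by (metis mult.assoc)+
  have Cv': "v * (C * f) = C * (v * f)" "u * (C * f) = C * (u * f)" for f
    using Cv by (metis mult.assoc)+
  have Uv: "fps_const U * v = v * fps_const U + C * v"
    unfolding v_def C_def by (rule exp_fps_commutator[OF UV _ V mq]) (rule c2(1)[symmetric])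
  have "fps_deriv ?G = fps_const (U + V + T) * ?G"
  proof -
    have "fps_deriv ?G = v * u * w * (fps_const T * t) + (v * u * (C * w)
        + (v * (fps_const U * u) + fps_const V * v * u) * w) * t"
      by (simp add: dv)
    \<comment> \<open>After \<open>T\<close> and \<open>C\<close> have been moved to the left, the
      \<open>C\<close> produced by differentiating \<open>w\<close> is exactly the correction that
      turns \<open>v U\<close> into \<open>U v\<close>.\<close>
    also have "\<dots> = fps_const T * ?G + ((C * v + v * fps_const U) * u * w * t + fps_const V * ?G)"
      by (simp only: distrib_left distrib_right mult.assoc Tv' Cv' add_ac)
    also have "C * v + v * fps_const U = fps_const U * v" using Uv by simp
    finally show ?thesis
      by (simp add: distrib_right mult.assoc flip: fps_const_add)
  qed
  then have G: "of_nat (fact k) * ?G $ k = (U + V + T) ^ k" for k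
    by (rule fps_deriv_eq_const_mult_power) (use mq in \<open>simp add: nth w_def\<close>)
  \<comment> \<open>A factor \<open>W^c\<close> counts for degree \<open>2c\<close>, so the joint
    vanishing of \<open>W\<close> and \<open>T\<close> gives the bound \<open>2 * m\<close>;
    treating \<open>w\<close> and \<open>t\<close> separately would give only
    \<open>3 * m\<close>.\<close>
  have wt0: "(w * t) $ k = 0" if "k \<ge> 2 * m" for k
    unfolding fps_mult_nth
  proof (rule sum.neutral, rule ballI)
    fix j assume "j \<in> {0..k}"
    then have "j div 2 + (k - j) \<ge> m" using that by auto
    then have "W ^ (j div 2) * T ^ (k - j) = 0" using van by auto
    then show "w $ j * t $ (k - j) = 0"
      by (simp add: w_def nth divided_power_def mult.assoc scalar_left_commute[of "W ^ _"])
  qed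
  have v0: "v $ k = 0" "u $ k = 0" "t $ k = 0" if "k \<ge> m" for k
    using that by (auto simp: nth intro: divided_power_eq_0[OF V] divided_power_eq_0[OF U] divided_power_eq_0[OF T])
  have w0: "w $ k = 0" if "k \<ge> 2 * m" for k
    using that by (auto simp: w_def intro!: divided_power_eq_0[OF W])
  have vu0: "(v * u) $ k = 0" if "k \<ge> m + m" for k
    using that by (intro fps_mult_eventually_zero[of m v m u] v0)
  \<comment> \<open>Each of the two groups vanishes from degree \<open>2 * m\<close> on, hence the
    bound \<open>4 * m\<close> for the product.\<close>
  have G': "?G = (v * u) * (w * t)" by (simp add: mult.assoc)
  have G0: "?G $ k = 0" if "k \<ge> 4 * m" for k
    unfolding G' by (rule fps_mult_eventually_zero[of "m + m" _ "2 * m"]) (use that vu0 wt0 in auto)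
  show "k \<ge> 4 * m \<Longrightarrow> (U + V + T) ^ k = 0" for k
    using G[of k] G0[of k] by simp
  have "(\<Sum>k<4 * m. divided_power (U + V + T) k) = (\<Sum>k<4*m. ?G $ k)"
    by (rule sum.cong[OF refl]) (use G m in \<open>auto intro!: divided_powerI[symmetric]\<close>)
  moreover have "(\<Sum>k<4*m. ?G $ k) = (\<Sum>k<m+m. (v * u) $ k) * (\<Sum>k<2*m. (w * t) $ k)"
    unfolding G' by (rule fps_mult_sum_coeffs) (use vu0 wt0 in auto)
  ultimately have 1: "(\<Sum>k<4 * m. divided_power (U + V + T) k) =
      (\<Sum>k<m+m. (v * u) $ k) * (\<Sum>k<2*m. (w * t) $ k)"
    by (rule trans)
  have 2: "(\<Sum>k<m+m. (v * u) $ k) = (\<Sum>k<m. divided_power V k) * (\<Sum>k<m. divided_power U k)"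
    by (subst fps_mult_sum_coeffs[of m _ m]) (use v0 in \<open>auto simp: nth\<close>)
  have "(\<Sum>k<2*m. (w * t) $ k) = (\<Sum>k<2*m+m. (w * t) $ k)"
    by (rule sum.mono_neutral_left) (auto simp: wt0)
  moreover have "(\<Sum>k<2*m+m. (w * t) $ k) = (\<Sum>k<2*m. w $ k) * (\<Sum>k<m. t $ k)"
    by (rule fps_mult_sum_coeffs) (use v0 w0 in auto)
  ultimately have 3: "(\<Sum>k<2*m. (w * t) $ k) = (\<Sum>k<2*m. w $ k) * (\<Sum>k<m. t $ k)"
    by (rule trans)
  have "(\<Sum>k<2*m. w $ k) = (\<Sum>k\<in>(*) 2 ` {..<m}. w $ k)"
  proof (rule sum.mono_neutral_right)
    have "odd k" if "k < 2 * m" "k \<notin> (*) 2 ` {..<m}" for k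
    proof
      assume "even k"
      then obtain j where "k = 2 * j" ..
      then show False using that by simp
    qed
    then show "\<forall>k\<in>{..<2*m} - (*) 2 ` {..<m}. w $ k = 0" by (simp add: w_def)
    show "(*) 2 ` {..<m} \<subseteq> {..<2*m}" by auto
    show "finite {..<2*m}" by (rule finite_lessThan)
  qed
  then have 4: "(\<Sum>k<2*m. w $ k) = (\<Sum>k<m. divided_power W k)"
    by (subst (asm) sum.reindex) (auto simp: inj_on_def w_def)
  have 5: "(\<Sum>k<m. t $ k) = (\<Sum>k<m. divided_power T k)" by (simp add: nth)
  have 6: "(\<Sum>k<m. divided_power W k) * (\<Sum>k<m. divided_power T k) = (\<Sum>k<m. divided_power (W + T) k)"
    by (rule divided_power_sum_commuting[OF comm(5) _ mq, symmetric]) (rule van)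
  show "(\<Sum>k<4 * m. divided_power (U + V + T) k) =
      (\<Sum>k<m. divided_power V k) * (\<Sum>k<m. divided_power U k) * (\<Sum>k<m. divided_power (W + T) k)"
    unfolding 1 2 3 4 5 6 ..
qed

end

section \<open>Divided powers in positive characteristic\<close>

lemma prime_dvd_choose_pos: "prime p \<Longrightarrow> 0 < k \<Longrightarrow> k < p \<Longrightarrow> p dvd (p choose k)" for p k :: nat
  by (rule dvd_choose_prime) auto

text \<open>In the Vandermonde sum only \<open>i = 0\<close> and \<open>i = p\<close> survive modulo
  \<open>p\<close>. This compares coefficients in
  \<open>(1 + t)^(p+a) = (1 + t^p)(1 + t)^a\<close>.\<close>

lemma of_nat_choose_add_char:
  assumes p: "prime p" and char: "of_nat p = (0::'r::ring_1)"
  shows "of_nat ((p + a) choose k) = (of_nat (a choose k) + (if k \<ge> p then of_nat (a choose (k - p)) else 0) :: 'r)"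
proof -
  have z: "of_nat (p choose i) = (0::'r)" if i: "i \<noteq> 0" "i \<noteq> p" for i
  proof (cases "i < p")
    case True
    then obtain c where "p choose i = p * c" using prime_dvd_choose_pos[OF p] i by (auto elim!: dvdE)
    then show ?thesis using char by simp
  qed (use i in \<open>auto simp: binomial_eq_0\<close>)
  have "of_nat ((p + a) choose k) = (\<Sum>i\<le>k. of_nat (p choose i) * of_nat (a choose (k - i)) :: 'r)"
    by (simp flip: vandermonde of_nat_mult)
  also have "\<dots> = (\<Sum>i\<in>{0} \<union> ({p} \<inter> {..k}). of_nat (p choose i) * of_nat (a choose (k - i)))"
  proof (rule sum.mono_neutral_right)
    show "\<forall>i\<in>{..k} - ({0} \<union> ({p} \<inter> {..k})). of_nat (p choose i) * of_nat (a choose (k - i)) = (0::'r)"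
    proof
      fix i assume "i \<in> {..k} - ({0} \<union> ({p} \<inter> {..k}))"
      then have "i \<noteq> 0" "i \<noteq> p" by auto
      then show "of_nat (p choose i) * of_nat (a choose (k - i)) = (0::'r)"
        using z[of i] by simp
    qed
  qed auto
  also have "\<dots> = of_nat (a choose k) + (if k \<ge> p then of_nat (a choose (k - p)) else 0)"
    using prime_gt_0_nat[OF p] by auto
  finally show ?thesis .
qed

text \<open>A case of Lucas' theorem: the previous recursion at multiples of \<open>p\<close>
  becomes Pascal's rule.\<close>

lemma of_nat_choose_mult_char:
  assumes p: "prime p" and char: "of_nat p = (0::'r::ring_1)"
  shows "of_nat ((p * a) choose (p * b)) = (of_nat (a choose b) :: 'r)"
proof (induction a arbitrary: b)
  case 0
  then show ?case using prime_gt_0_nat[OF p] by (cases b) (auto simp: binomial_eq_0)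
next
  case (Suc a)
  show ?case
  proof (cases b)
    case (Suc c)
    then show ?thesis
      using of_nat_choose_add_char[OF p char, of "p * a" "p * Suc c"] Suc.IH[of c] Suc.IH[of "Suc c"]
      by (simp add: add.commute)
  qed simp
qed

text \<open>Another case of Lucas' theorem: as \<open>d < p\<close>, adding \<open>p\<close> to the
  upper entry changes nothing.\<close>

lemma of_nat_choose_digit_char:
  assumes p: "prime p" and char: "of_nat p = (0::'r::ring_1)" and d: "d < p"
  shows "of_nat ((p * a + d) choose d) = (1 :: 'r)"
proof (induction a)
  case (Suc a)
  then show ?case
    using of_nat_choose_add_char[OF p char, of "p * a + d" d] d by (simp add: add.assoc)
qed simp

lemma sum_commute:
  fixes f g :: "_ \<Rightarrow> 'r::ring_1"
  assumes "\<And>i j. i \<in> A \<Longrightarrow> j \<in> B \<Longrightarrow> f i * g j = g j * f i"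
  shows "sum f A * sum g B = sum g B * sum f A"
  unfolding sum_product by (subst sum.swap) (auto intro!: sum.cong simp: assms)

section \<open>The Heisenberg exponential as an ordered product\<close>

context exp_scalars
begin

lemma scaled_mult: "(\<sigma> a * N) * (\<sigma> b * M) = \<sigma> (a * b) * (N * M)"
proof -
  have "(\<sigma> a * N) * (\<sigma> b * M) = \<sigma> a * (\<sigma> b * (N * M))"
    unfolding mult.assoc by (rule arg_cong[OF scalar_left_commute])
  then show ?thesis by (simp only: scalar_mult mult.assoc)
qed

lemma scaled_commute: "N * M = M * N \<Longrightarrow> (\<sigma> a * N) * (\<sigma> b * M) = (\<sigma> b * M) * (\<sigma> a * N)"
  by (simp only: scaled_mult mult.commute[of a])

lemma scaled_power: "(\<sigma> a * N) ^ k = \<sigma> (a ^ k) * N ^ k"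
proof (induction k)
  case (Suc k)
  show ?case unfolding power_Suc Suc scaled_mult ..
qed (simp add: scalar_1)

text \<open>This is \<open>exp_commutator_sum\<close> for \<open>U = xX\<close>,
  \<open>V = yY\<close>, \<open>W = (xy/2)Z\<close> and \<open>T = (z - xy/2)Z\<close>. Here
  \<open>W + T = zZ\<close>, so the last factor is the exponential of \<open>zZ\<close>.\<close>

lemma exp_heisenberg:
  assumes XY: "X * Y = Y * X + Z" and ZX: "Z * X = X * Z" and ZY: "Z * Y = Y * Z"
    and nil: "X ^ m = 0" "Y ^ m = 0" "Z ^ m = 0" and m: "4 * m \<le> q" "m > 0"
  shows "k \<ge> 4 * m \<Longrightarrow> (\<sigma> x * X + \<sigma> y * Y + \<sigma> (z - \<phi> 2 * (x * y)) * Z) ^ k = 0"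
    and "(\<Sum>k<4 * m. divided_power (\<sigma> x * X + \<sigma> y * Y + \<sigma> (z - \<phi> 2 * (x * y)) * Z) k) =
      (\<Sum>k<m. divided_power (\<sigma> y * Y) k) * (\<Sum>k<m. divided_power (\<sigma> x * X) k) *
      (\<Sum>k<m. divided_power (\<sigma> z * Z) k)"
proof -
  define w where "w = \<phi> 2 * (x * y)"
  define t where "t = z - w"
  have half: "2 * \<phi> 2 = 1" using inverse_fact[of 2] m by (simp add: mult.commute)
  have wt: "\<sigma> w * Z + \<sigma> t * Z = \<sigma> z * Z"
    by (simp add: t_def flip: distrib_right scalar_add)
  have "2 * w = x * y" unfolding w_def mult.assoc[symmetric] half by simp
  then have "\<sigma> (x * y) = 2 * \<sigma> w"
    unfolding mult_2 by (metis scalar_add)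
  then have UV: "(\<sigma> x * X) * (\<sigma> y * Y) = (\<sigma> y * Y) * (\<sigma> x * X) + 2 * (\<sigma> w * Z)"
    unfolding scaled_mult XY distrib_left mult.commute[of y] by (simp only: mult.assoc)
  \<comment> \<open>Both elements are scalar multiples of \<open>Z\<close>, so the mixed product is
    a multiple of \<open>Z^(c+d)\<close>.\<close>
  have van: "(\<sigma> w * Z) ^ c * (\<sigma> t * Z) ^ d = 0" if "c + d \<ge> m" for c d
  proof -
    have "Z ^ c * Z ^ d = Z ^ m * Z ^ (c + d - m)" using that by (simp flip: power_add)
    then show ?thesis by (simp add: scaled_power scaled_mult nil)
  qed
  have nil': "(\<sigma> y * Y) ^ m = 0" "(\<sigma> x * X) ^ m = 0" by (simp_all add: scaled_power nil)
  have comm: "(\<sigma> x * X) * (\<sigma> w * Z) = (\<sigma> w * Z) * (\<sigma> x * X)"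
    "(\<sigma> y * Y) * (\<sigma> w * Z) = (\<sigma> w * Z) * (\<sigma> y * Y)"
    "(\<sigma> x * X) * (\<sigma> t * Z) = (\<sigma> t * Z) * (\<sigma> x * X)"
    "(\<sigma> y * Y) * (\<sigma> t * Z) = (\<sigma> t * Z) * (\<sigma> y * Y)"
    "(\<sigma> w * Z) * (\<sigma> t * Z) = (\<sigma> t * Z) * (\<sigma> w * Z)"
    by (rule scaled_commute, simp only: ZX ZY)+
  show "k \<ge> 4 * m \<Longrightarrow> (\<sigma> x * X + \<sigma> y * Y + \<sigma> (z - \<phi> 2 * (x * y)) * Z) ^ k = 0"
    unfolding w_def[symmetric] t_def[symmetric]
    by (rule exp_commutator_sum(1)[OF UV comm nil' _ m]) (rule van)
  show "(\<Sum>k<4 * m. divided_power (\<sigma> x * X + \<sigma> y * Y + \<sigma> (z - \<phi> 2 * (x * y)) * Z) k) =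
      (\<Sum>k<m. divided_power (\<sigma> y * Y) k) * (\<Sum>k<m. divided_power (\<sigma> x * X) k) *
      (\<Sum>k<m. divided_power (\<sigma> z * Z) k)"
    unfolding w_def[symmetric] t_def[symmetric] wt[symmetric]
    by (rule exp_commutator_sum(2)[OF UV comm nil' _ m]) (rule van)
qed

text \<open>The order y, x, z of the factors is the one in which the dual basis elements factor
  without correction terms. \<open>L\<close> serves as a cutoff beyond all exponents that
  occur.\<close>

definition coord_sum :: "(nat \<Rightarrow> 'r) \<Rightarrow> (nat \<Rightarrow> 'r) \<Rightarrow> (nat \<Rightarrow> 'r) \<Rightarrow> nat \<Rightarrow> 'c \<Rightarrow> 'c \<Rightarrow> 'c \<Rightarrow> 'r" where
  "coord_sum xs ys zs L x y z =
    (\<Sum>b<L. \<sigma> (y ^ b) * ys b) * (\<Sum>a<L. \<sigma> (x ^ a) * xs a) * (\<Sum>c<L. \<sigma> (z ^ c) * zs c)"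

text \<open>The cutoff \<open>4 * m\<close> is the degree from which the powers of the exponent
  vanish by \<open>exp_heisenberg\<close>.\<close>

definition exp_sum :: "nat \<Rightarrow> 'c \<Rightarrow> 'c \<Rightarrow> 'c \<Rightarrow> 'r \<Rightarrow> 'r \<Rightarrow> 'r \<Rightarrow> 'r" where
  "exp_sum m x y z X Y Z =
    (\<Sum>k<4 * m. divided_power (\<sigma> x * X + \<sigma> y * Y + \<sigma> (z - \<phi> 2 * (x * y)) * Z) k)"

end

text \<open>The algebra of distributions of the Heisenberg group: \<open>xs i\<close>, \<open>ys i\<close>, \<open>zs i\<close> are the
  elements dual to \<open>x\<^sup>i\<close>, \<open>y\<^sup>i\<close>, \<open>z\<^sup>i\<close>, acting in a representation of dimension \<open>n\<close>.\<close>

locale heisenberg_seq =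
  fixes n :: nat and xs ys zs :: "nat \<Rightarrow> 'r::ring_1"
  assumes zeroth: "xs 0 = 1" "ys 0 = 1" "zs 0 = 1"
    and divided: "xs i * xs j = of_nat ((i + j) choose i) * xs (i + j)"
      "ys i * ys j = of_nat ((i + j) choose i) * ys (i + j)"
      "zs i * zs j = of_nat ((i + j) choose i) * zs (i + j)"
    and central: "zs i * xs j = xs j * zs i" "zs i * ys j = ys j * zs i"
    and commutation: "xs i * ys j = (\<Sum>t\<le>min i j. ys (j - t) * xs (i - t) * zs t)"
    and nilpotent: "a > 0 \<Longrightarrow> xs a ^ n = 0" "a > 0 \<Longrightarrow> ys a ^ n = 0" "a > 0 \<Longrightarrow> zs a ^ n = 0"

lemma divided_sequence_power:
  fixes f :: "nat \<Rightarrow> 'r::ring_1"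
  assumes "f 0 = 1" "\<And>i j. f i * f j = of_nat ((i + j) choose i) * f (i + j)"
  shows "f 1 ^ k = of_nat (fact k) * f k"
proof (induction k)
  case (Suc k)
  have "f 1 ^ Suc k = f 1 ^ k * f 1" by (rule power_Suc2)
  also have "\<dots> = of_nat (fact k) * (of_nat (Suc k) * f (Suc k))"
    using assms(2)[of k 1] by (simp only: Suc mult.assoc) simp
  also have "\<dots> = of_nat (fact k * Suc k) * f (Suc k)"
    unfolding of_nat_mult mult.assoc ..
  finally show ?case by (simp only: fact_Suc mult.commute of_nat_id)
qed (use assms in simp)

lemma divided_sequence_commute:
  fixes f :: "nat \<Rightarrow> 'r::ring_1"
  assumes "\<And>i j. f i * f j = of_nat ((i + j) choose i) * f (i + j)"
  shows "f i * f j = f j * f i"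
  using binomial_symmetric[of i "i + j"] by (simp add: assms add.commute)

lemma (in heisenberg_seq) commutator_1: "xs 1 * ys 1 = ys 1 * xs 1 + zs 1"
proof -
  have "{..1} = {0, 1::nat}" by auto
  then show ?thesis using commutation[of 1 1] zeroth by simp
qed

section \<open>Base-\<open>p\<close> digits and Frobenius shifts\<close>

locale heisenberg_char = heisenberg_seq n xs ys zs + exp_scalars \<sigma> \<phi> p
  for n and xs ys zs :: "nat \<Rightarrow> 'r::ring_1" and \<sigma> :: "'c::comm_ring_1 \<Rightarrow> 'r" and \<phi> and p +
  assumes prime: "prime p" and char: "of_nat p = (0::'r)" and large: "4 * n \<le> p" "n > 0"
begin

lemma p_pos: "p > 0"
  using prime by (rule prime_gt_0_nat)

text \<open>By Lucas' theorem the binomial coefficient in \<open>divided\<close> becomes 1 when the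
  lowest base-\<open>p\<close> digit \<open>d\<close> is split off.\<close>

lemma split_digit:
  assumes "d < p"
  shows "xs (p * a + d) = xs d * xs (p * a)" "ys (p * a + d) = ys d * ys (p * a)"
    "zs (p * a + d) = zs d * zs (p * a)"
proof -
  have "of_nat ((d + p * a) choose d) = (1::'r)"
    using of_nat_choose_digit_char[OF prime char assms, of a] by (simp add: add.commute)
  then show "xs (p * a + d) = xs d * xs (p * a)" "ys (p * a + d) = ys d * ys (p * a)"
    "zs (p * a + d) = zs d * zs (p * a)"
    using divided[of d "p * a"] by (simp_all only: add.commute[of d] mult_1)
qed

lemma digit_eq_divided_power:
  assumes "d < p"
  shows "xs d = divided_power (xs 1) d" "ys d = divided_power (ys 1) d" "zs d = divided_power (zs 1) d"
  using divided_sequence_power[of xs d] divided_sequence_power[of ys d] divided_sequence_power[of zs d]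
    zeroth divided assms
  by (auto intro!: divided_powerI)

text \<open>The lowest digit contributes the factor \<open>N^d / d!\<close> with
  \<open>N^n = 0\<close>.\<close>

lemma large_digit_eq_0:
  assumes "d < p" "n \<le> d"
  shows "xs (p * a + d) = 0" "ys (p * a + d) = 0" "zs (p * a + d) = 0"
  using split_digit[OF assms(1), of a] digit_eq_divided_power[OF assms(1)] nilpotent[of 1]
    divided_power_eq_0[OF _ assms(2)] by simp_all

text \<open>Write a summation index as \<open>t = p s + d\<close> with \<open>0 < d < p\<close>.
  Then \<open>zs t\<close> has lowest digit \<open>d\<close> and \<open>xs (p * i - t)\<close> has
  lowest digit \<open>p - d\<close>. One of these is at least \<open>n\<close>, so the term is 0 and
  only multiples of \<open>p\<close> remain.\<close>

lemma shift_commutation: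
  "xs (p * i) * ys (p * j) = (\<Sum>t\<le>min i j. ys (p * (j - t)) * xs (p * (i - t)) * zs (p * t))"
proof -
  let ?f = "\<lambda>t. ys (p * j - t) * xs (p * i - t) * zs t"
  have "xs (p * i) * ys (p * j) = (\<Sum>t\<le>min (p * i) (p * j). ?f t)"
    by (rule commutation)
  also have "\<dots> = (\<Sum>t\<in>(*) p ` {..min i j}. ?f t)"
  proof (rule sum.mono_neutral_right)
    show "(*) p ` {..min i j} \<subseteq> {..min (p * i) (p * j)}" by auto
    show "\<forall>t\<in>{..min (p * i) (p * j)} - (*) p ` {..min i j}. ?f t = 0"
    proof
      fix t assume t: "t \<in> {..min (p * i) (p * j)} - (*) p ` {..min i j}"
      define d where "d = t mod p"
      define s where "s = t div p"
      have ts: "t = p * s + d" by (simp add: d_def s_def)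
      have "d < p" using p_pos by (simp add: d_def)
      have "s \<le> i" "s \<le> j" using t p_pos by (auto simp: s_def div_le_mono less_mult_imp_div_less
          dest: div_le_mono[of _ _ p])
      then have "d > 0" using t by (cases "d = 0") (auto simp: ts)
      then have "s < i" using t \<open>s \<le> i\<close> by (auto simp: ts dest: le_neq_implies_less)
      \<comment> \<open>One multiple of \<open>p\<close> is borrowed here in order to read off the
        lowest digit of \<open>p * i - t\<close>.\<close>
      then have "p * i = p * (i - s - 1) + p * s + p"
        by (metis add.commute add.left_commute add_mult_distrib2 le_add_diff_inverse mult.right_neutral
            Suc_leI diff_Suc_eq_diff_pred less_or_eq_imp_le One_nat_def plus_1_eq_Suc diff_diff_left)
      then have xi: "p * i - t = p * (i - s - 1) + (p - d)"
        using \<open>d < p\<close> by (simp add: ts)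
      show "?f t = 0"
      proof (cases "n \<le> d")
        case True
        then show ?thesis using large_digit_eq_0(3)[OF \<open>d < p\<close>, of s] ts by simp
      next
        case False
        then have "n \<le> p - d" using large by simp
        then show ?thesis using large_digit_eq_0(1)[of "p - d" "i - s - 1"] xi \<open>d > 0\<close> p_pos by simp
      qed
    qed
  qed simp
  also have "\<dots> = (\<Sum>t\<le>min i j. ?f (p * t))"
    using p_pos by (subst sum.reindex) (auto simp: inj_on_def)
  finally show ?thesis by (simp only: right_diff_distrib')
qed

text \<open>Closure of the hypotheses under passing to indices divisible by \<open>p\<close> is what
  makes the inductions on the number of exponential factors possible.\<close>

lemma heisenberg_char_shift:
  "heisenberg_char n (\<lambda>a. xs (p * a)) (\<lambda>a. ys (p * a)) (\<lambda>a. zs (p * a)) \<sigma> \<phi> p"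
proof unfold_locales
  fix i j :: nat
  show "xs (p * i) * ys (p * j) = (\<Sum>t\<le>min i j. ys (p * (j - t)) * xs (p * (i - t)) * zs (p * t))"
    by (rule shift_commutation)
  have c: "of_nat (p * i + p * j choose (p * i)) = (of_nat (i + j choose i) :: 'r)"
    using of_nat_choose_mult_char[OF prime char, of "i + j" i] by (simp add: distrib_left)
  show "xs (p * i) * xs (p * j) = of_nat (i + j choose i) * xs (p * (i + j))"
    "ys (p * i) * ys (p * j) = of_nat (i + j choose i) * ys (p * (i + j))"
    "zs (p * i) * zs (p * j) = of_nat (i + j choose i) * zs (p * (i + j))"
    using divided[of "p * i" "p * j"] by (simp_all only: c distrib_left)
qed (use zeroth central nilpotent prime char large p_pos in \<open>simp_all\<close>)

text \<open>The commutation sum has only the terms \<open>t = 0\<close> and \<open>t = 1\<close>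
  when \<open>j > 0\<close>. The second contains an element of index \<open>p * j - 1\<close>, whose
  lowest digit \<open>p - 1\<close> is at least \<open>n\<close>, so it vanishes.\<close>

lemma commute_shift: "xs 1 * ys (p * j) = ys (p * j) * xs 1" "xs (p * j) * ys 1 = ys 1 * xs (p * j)"
proof -
  show "xs 1 * ys (p * j) = ys (p * j) * xs 1"
  proof (cases j)
    case (Suc i)
    have d: "p * j - 1 = p * i + (p - 1)" using Suc p_pos by simp
    have "n \<le> p - 1" using large by simp
    then have "ys (p * j - 1) = 0" unfolding d using p_pos by (intro large_digit_eq_0) auto
    moreover have "{..min 1 (p * j)} = {0, 1}" using Suc p_pos by auto
    ultimately show ?thesis using commutation[of 1 "p * j"] zeroth by simp
  qed (simp add: zeroth)
  show "xs (p * j) * ys 1 = ys 1 * xs (p * j)"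
  proof (cases j)
    case (Suc i)
    have d: "p * j - 1 = p * i + (p - 1)" using Suc p_pos by simp
    have "n \<le> p - 1" using large by simp
    then have "xs (p * j - 1) = 0" unfolding d using p_pos by (intro large_digit_eq_0) auto
    moreover have "{..min (p * j) 1} = {0, 1}" using Suc p_pos by auto
    ultimately show ?thesis using commutation[of "p * j" 1] zeroth by simp
  qed (simp add: zeroth)
qed

text \<open>Writing \<open>b = p a + d\<close> factors the sum into a digit part and a Frobenius
  part; digits from \<open>n\<close> on contribute nothing.\<close>

lemma sum_split_digit:
  fixes f :: "nat \<Rightarrow> 'r"
  assumes "\<And>a d. d < p \<Longrightarrow> f (p * a + d) = f d * f (p * a)"
    and dp: "\<And>d. d < p \<Longrightarrow> f d = divided_power (f 1) d" and nil: "f 1 ^ n = 0"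
  shows "(\<Sum>b<p * L. \<sigma> (y ^ b) * f b) =
    (\<Sum>d<n. divided_power (\<sigma> y * f 1) d) * (\<Sum>b<L. \<sigma> ((y ^ p) ^ b) * f (p * b))"
proof -
  have "(\<Sum>b<p * L. \<sigma> (y ^ b) * f b) = (\<Sum>(d, a)\<in>{..<p} \<times> {..<L}. \<sigma> (y ^ (p * a + d)) * f (p * a + d))"
  proof (rule sum.reindex_bij_witness[of _ "\<lambda>(d, a). p * a + d" "\<lambda>b. (b mod p, b div p)"])
    fix da assume "da \<in> {..<p} \<times> {..<L}"
    then obtain d a where da: "da = (d, a)" "d < p" "a < L" by auto
    then have "p * a + d < p * Suc a" by simp
    also have "\<dots> \<le> p * L" using da by (intro mult_le_mono2) simp
    finally show "(case da of (d, a) \<Rightarrow> p * a + d) \<in> {..<p * L}" using da by simp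
    show "((case da of (d, a) \<Rightarrow> p * a + d) mod p, (case da of (d, a) \<Rightarrow> p * a + d) div p) = da"
      using da by simp
  qed (use p_pos in \<open>auto simp: less_mult_imp_div_less mult.commute\<close>)
  also have "\<dots> = (\<Sum>(d, a)\<in>{..<p} \<times> {..<L}. (\<sigma> (y ^ d) * f d) * (\<sigma> ((y ^ p) ^ a) * f (p * a)))"
  proof (rule sum.cong)
    have "\<sigma> (y ^ (p * a + d)) * f (p * a + d) = \<sigma> (y ^ d) * f d * (\<sigma> ((y ^ p) ^ a) * f (p * a))"
      if "d < p" for a d
    proof -
      have "y ^ (p * a + d) = y ^ d * (y ^ p) ^ a" by (simp add: power_add power_mult)
      then show ?thesis by (simp only: assms(1)[OF that] scaled_mult)
    qed
    then show "(case da of (d, a) \<Rightarrow> \<sigma> (y ^ (p * a + d)) * f (p * a + d)) =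
        (case da of (d, a) \<Rightarrow> \<sigma> (y ^ d) * f d * (\<sigma> ((y ^ p) ^ a) * f (p * a)))"
      if "da \<in> {..<p} \<times> {..<L}" for da using that by auto
  qed (rule refl)
  also have "\<dots> = (\<Sum>d<p. \<sigma> (y ^ d) * f d) * (\<Sum>b<L. \<sigma> ((y ^ p) ^ b) * f (p * b))"
    by (simp add: sum_product sum.cartesian_product)
  also have "(\<Sum>d<p. \<sigma> (y ^ d) * f d) = (\<Sum>d<p. divided_power (\<sigma> y * f 1) d)"
    by (rule sum.cong) (use dp in \<open>auto simp: divided_power_scaled\<close>)
  also have "\<dots> = (\<Sum>d<n. divided_power (\<sigma> y * f 1) d)"
  proof (rule sum.mono_neutral_right)
    have "(\<sigma> y * f 1) ^ n = 0" by (simp only: scaled_power nil mult_zero_right)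
    then show "\<forall>i\<in>{..<p} - {..<n}. divided_power (\<sigma> y * f 1) i = 0"
      by (auto intro: divided_power_eq_0 simp del: One_nat_def)
  qed (use large in auto)
  finally show ?thesis .
qed

lemma coord_sum_step:
  "coord_sum xs ys zs (p * L) x y z = exp_sum n x y z (xs 1) (ys 1) (zs 1) *
    coord_sum (\<lambda>a. xs (p * a)) (\<lambda>a. ys (p * a)) (\<lambda>a. zs (p * a)) L (x ^ p) (y ^ p) (z ^ p)"
proof -
  have nil: "xs 1 ^ n = 0" "ys 1 ^ n = 0" "zs 1 ^ n = 0" using nilpotent by simp_all
  define X Y Z where "X = (\<Sum>d<n. divided_power (\<sigma> x * xs 1) d)"
    and "Y = (\<Sum>d<n. divided_power (\<sigma> y * ys 1) d)" and "Z = (\<Sum>d<n. divided_power (\<sigma> z * zs 1) d)"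
  define X' Y' Z' where "X' = (\<Sum>b<L. \<sigma> ((x ^ p) ^ b) * xs (p * b))"
    and "Y' = (\<Sum>b<L. \<sigma> ((y ^ p) ^ b) * ys (p * b))" and "Z' = (\<Sum>b<L. \<sigma> ((z ^ p) ^ b) * zs (p * b))"
  have X: "(\<Sum>b<p * L. \<sigma> (x ^ b) * xs b) = X * X'" unfolding X_def X'_def
    by (rule sum_split_digit) (rule split_digit digit_eq_divided_power nil | assumption)+
  have Y: "(\<Sum>b<p * L. \<sigma> (y ^ b) * ys b) = Y * Y'" unfolding Y_def Y'_def
    by (rule sum_split_digit) (rule split_digit digit_eq_divided_power nil | assumption)+
  have Z: "(\<Sum>b<p * L. \<sigma> (z ^ b) * zs b) = Z * Z'" unfolding Z_def Z'_def
    by (rule sum_split_digit) (rule split_digit digit_eq_divided_power nil | assumption)+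
  \<comment> \<open>To collect the digit parts on the left, \<open>Y'\<close> has to pass
    \<open>X\<close> and \<open>Z\<close>, and \<open>X'\<close> has to pass \<open>Z\<close>. Only
    the first exchange is not covered by the centrality of \<open>zs\<close>.\<close>
  have c: "Y' * X = X * Y'" unfolding Y'_def X_def divided_power_scaled
    by (rule sum_commute, rule scaled_commute, rule divided_power_commute[symmetric], rule commute_shift)
  have c2: "Y' * Z = Z * Y'" unfolding Y'_def Z_def divided_power_scaled
    by (rule sum_commute, rule scaled_commute, rule divided_power_commute[symmetric], rule central)
  have c3: "X' * Z = Z * X'" unfolding X'_def Z_def divided_power_scaled
    by (rule sum_commute, rule scaled_commute, rule divided_power_commute[symmetric], rule central)
  have "exp_sum n x y z (xs 1) (ys 1) (zs 1) = Y * X * Z"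
    unfolding exp_sum_def X_def Y_def Z_def
    by (rule exp_heisenberg(2)[OF commutator_1 central nil large])
  moreover have "(Y * Y') * (X * X') * (Z * Z') = Y * X * Z * (Y' * X' * Z')"
  proof -
    have "(Y * Y') * (X * X') * (Z * Z') = Y * (Y' * X) * (X' * Z) * Z'" by (simp only: mult.assoc)
    also have "\<dots> = Y * X * (Y' * Z) * X' * Z'" unfolding c c3 by (simp only: mult.assoc)
    also have "\<dots> = Y * X * Z * (Y' * X' * Z')" unfolding c2 by (simp only: mult.assoc)
    finally show ?thesis .
  qed
  ultimately show ?thesis
    unfolding coord_sum_def X Y Z X'_def[symmetric] Y'_def[symmetric] Z'_def[symmetric] by simp
qed

end

text \<open>With cutoff \<open>q ^ m\<close> the peeling step applies \<open>m\<close> times and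
  ends at cutoff 1, where only the zeroth elements remain. Sequences and coordinates are generalized
  because each step replaces them by the shifted sequences and by \<open>q\<close>-th
  powers.\<close>

lemma (in exp_scalars) coord_sum_eq_exp_prod:
  assumes "heisenberg_char n xs ys zs \<sigma> \<phi> q"
  shows "coord_sum xs ys zs (q ^ m) x y z =
    foldr (\<lambda>i B. exp_sum n (x ^ q ^ i) (y ^ q ^ i) (z ^ q ^ i) (xs (q ^ i)) (ys (q ^ i)) (zs (q ^ i)) * B)
      [0..<m] 1"
  using assms
proof (induction m arbitrary: xs ys zs x y z)
  case 0
  interpret heisenberg_char n xs ys zs \<sigma> \<phi> q by fact
  show ?case by (simp add: coord_sum_def zeroth scalar_1)
next
  case (Suc m)
  interpret heisenberg_char n xs ys zs \<sigma> \<phi> q by fact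
  have upt: "[0..<Suc m] = 0 # map Suc [0..<m]" by (simp add: upt_conv_Cons map_Suc_upt)
  show ?case
    unfolding power_Suc coord_sum_step Suc.IH[OF heisenberg_char_shift] upt list.simps foldr.simps
      foldr_map o_def power_0 power_one_right power_mult mult_1_right
    by (simp add: o_def)
qed

lemma heisenberg_char_commutator:
  assumes "heisenberg_char n xs ys zs \<sigma> \<phi> p"
  shows "xs (p ^ i) * ys (p ^ i) = ys (p ^ i) * xs (p ^ i) + zs (p ^ i)"
  using assms
proof (induction i arbitrary: xs ys zs)
  case 0
  interpret heisenberg_char n xs ys zs \<sigma> \<phi> p by fact
  show ?case using commutator_1 by simp
next
  case (Suc i)
  show ?case using Suc.IH[OF heisenberg_char.heisenberg_char_shift[OF Suc.prems]] by simp
qed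

text \<open>Each shift lowers both exponents by one. As they differ, one reaches 0 while the other
  is still positive, and then \<open>commute_shift\<close> applies.\<close>

lemma heisenberg_char_commute:
  assumes "heisenberg_char n xs ys zs \<sigma> \<phi> p" and "i \<noteq> j"
  shows "xs (p ^ i) * ys (p ^ j) = ys (p ^ j) * xs (p ^ i)"
  using assms
proof (induction i arbitrary: j xs ys zs)
  case 0
  interpret heisenberg_char n xs ys zs \<sigma> \<phi> p by fact
  show ?case using commute_shift(1)[of "p ^ (j - 1)"] 0 by (cases j) simp_all
next
  case (Suc i)
  interpret heisenberg_char n xs ys zs \<sigma> \<phi> p by fact
  show ?case
  proof (cases j)
    case 0
    then show ?thesis using commute_shift(2)[of "p ^ i"] by simp
  next
    case (Suc l)
    then show ?thesis using Suc.IH[OF heisenberg_char_shift, of l] Suc.prems by simp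
  qed
qed

section \<open>The endomorphism ring of a sequence space\<close>

text \<open>The matrices of a fixed size are not a type; computing in this ring instead makes the
  type class algebra of noncommutative rings available for them.\<close>

typedef (overloaded) 'c lin_op = "{f :: (nat \<Rightarrow> 'c::comm_ring_1) \<Rightarrow> nat \<Rightarrow> 'c.
    (\<forall>u v. f (\<lambda>i. u i + v i) = (\<lambda>i. f u i + f v i)) \<and> (\<forall>c u. f (\<lambda>i. c * u i) = (\<lambda>i. c * f u i))}"
  by (rule exI[of _ "\<lambda>u. u"]) simp

setup_lifting type_definition_lin_op

instantiation lin_op :: (comm_ring_1) ring_1
begin

lift_definition zero_lin_op :: "'a lin_op" is "\<lambda>u i. 0" by simp
lift_definition one_lin_op :: "'a lin_op" is "\<lambda>u. u" by simp
lift_definition plus_lin_op :: "'a lin_op \<Rightarrow> 'a lin_op \<Rightarrow> 'a lin_op" is "\<lambda>f g u i. f u i + g u i"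
  by (simp add: algebra_simps)
lift_definition minus_lin_op :: "'a lin_op \<Rightarrow> 'a lin_op \<Rightarrow> 'a lin_op" is "\<lambda>f g u i. f u i - g u i"
  by (simp add: algebra_simps)
lift_definition uminus_lin_op :: "'a lin_op \<Rightarrow> 'a lin_op" is "\<lambda>f u i. - f u i"
  by simp
lift_definition times_lin_op :: "'a lin_op \<Rightarrow> 'a lin_op \<Rightarrow> 'a lin_op" is "\<lambda>f g u. f (g u)"
  by simp

instance
proof
  show "(0::'a lin_op) \<noteq> 1"
    by transfer (metis zero_neq_one)
qed (transfer; simp add: algebra_simps fun_eq_iff)+

end

lift_definition op_scalar :: "'c::comm_ring_1 \<Rightarrow> 'c lin_op" is "\<lambda>c u i. c * u i"
  by (simp add: algebra_simps)

lemma op_scalar_add: "op_scalar (a + b) = op_scalar a + op_scalar b"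
  by transfer (simp add: algebra_simps)

lemma op_scalar_mult: "op_scalar (a * b) = op_scalar a * op_scalar b"
  by transfer (simp add: algebra_simps)

lemma op_scalar_1: "op_scalar 1 = 1"
  by transfer simp

lemma op_scalar_0: "op_scalar 0 = 0"
  by transfer simp

lemma op_scalar_central: "op_scalar a * f = f * op_scalar a"
  by transfer simp

text \<open>Repeating the \<open>n \<times> n\<close> block along the diagonal makes the embedding of the matrix ring
  unital.\<close>

lift_definition mat_op :: "nat \<Rightarrow> 'c::comm_ring_1 mat \<Rightarrow> 'c lin_op" is
  "\<lambda>n M u i. \<Sum>s<n. M $$ (i mod n, s) * u (i div n * n + s)"
  by (auto simp: algebra_simps sum.distrib sum_distrib_left)

context
  fixes n :: nat
  assumes n: "n > 0"
begin

lemma mat_op_add: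
  "M \<in> carrier_mat n n \<Longrightarrow> N \<in> carrier_mat n n \<Longrightarrow> mat_op n (M + N) = mat_op n M + mat_op n N"
  using n by transfer (auto simp: fun_eq_iff distrib_right sum.distrib intro!: sum.cong)

lemma mat_op_minus:
  "M \<in> carrier_mat n n \<Longrightarrow> N \<in> carrier_mat n n \<Longrightarrow> mat_op n (M - N) = mat_op n M - mat_op n N"
  using n by transfer (auto simp: fun_eq_iff left_diff_distrib sum_subtractf[symmetric] intro!: sum.cong)

lemma mat_op_smult: "M \<in> carrier_mat n n \<Longrightarrow> mat_op n (c \<cdot>\<^sub>m M) = op_scalar c * mat_op n M"
  using n by transfer (auto simp: fun_eq_iff sum_distrib_left mult.assoc intro!: sum.cong)

lemma mat_op_zero: "mat_op n (0\<^sub>m n n) = 0"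
  using n by transfer (auto simp: fun_eq_iff)

lemma mat_op_one: "mat_op n (1\<^sub>m n :: 'c::comm_ring_1 mat) = 1"
proof -
  have "(\<Sum>s<n. 1\<^sub>m n $$ (i mod n, s) * u (i div n * n + s)) = u i" for u :: "nat \<Rightarrow> 'c" and i
  proof -
    have "(\<Sum>s<n. 1\<^sub>m n $$ (i mod n, s) * u (i div n * n + s)) =
        (\<Sum>s<n. if s = i mod n then u (i div n * n + s) else 0)"
      using n by (intro sum.cong) auto
    then show ?thesis using n by simp
  qed
  then show ?thesis
    by (simp only: Rep_lin_op_inject[symmetric] mat_op.rep_eq one_lin_op.rep_eq)
qed

lemma mat_op_mult:
  fixes M :: "'c::comm_ring_1 mat"
  assumes "M \<in> carrier_mat n n" "N \<in> carrier_mat n n"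
  shows "mat_op n (M * N) = mat_op n M * mat_op n N"
proof -
  have "(\<Sum>s<n. (M * N) $$ (i mod n, s) * u (i div n * n + s)) =
      (\<Sum>s<n. M $$ (i mod n, s) * (\<Sum>t<n. N $$ ((i div n * n + s) mod n, t) *
        u ((i div n * n + s) div n * n + t)))" for u :: "nat \<Rightarrow> 'c" and i
  proof -
    have "(\<Sum>s<n. (M * N) $$ (i mod n, s) * u (i div n * n + s)) =
        (\<Sum>s<n. \<Sum>t<n. M $$ (i mod n, t) * N $$ (t, s) * u (i div n * n + s))"
      using n assms by (intro sum.cong)
        (auto simp: scalar_prod_def sum_distrib_right atLeast0LessThan)
    also have "\<dots> = (\<Sum>t<n. \<Sum>s<n. M $$ (i mod n, t) * N $$ (t, s) * u (i div n * n + s))"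
      by (rule sum.swap)
    also have "\<dots> = (\<Sum>s<n. M $$ (i mod n, s) * (\<Sum>t<n. N $$ ((i div n * n + s) mod n, t) *
        u ((i div n * n + s) div n * n + t)))"
      by (intro sum.cong) (auto simp: sum_distrib_left mult.assoc)
    finally show ?thesis .
  qed
  then show ?thesis
    by (simp only: Rep_lin_op_inject[symmetric] mat_op.rep_eq times_lin_op.rep_eq)
qed

lemma mat_op_power: "M \<in> carrier_mat n n \<Longrightarrow> mat_op n (M ^\<^sub>m k) = mat_op n M ^ k"
proof (induction k)
  case (Suc k)
  then show ?case using mat_op_mult[of "M ^\<^sub>m k" M] by (simp add: power_Suc2 del: power_Suc)
qed (simp add: mat_op_one)

lemma mat_op_sum:
  assumes "finite S"
  shows "mat_op n (mat n n (\<lambda>ij. \<Sum>r\<in>S. f r ij)) = (\<Sum>r\<in>S. mat_op n (mat n n (f r)))"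
  using assms
proof (induction S rule: finite_induct)
  case empty
  have "mat n n (\<lambda>ij. \<Sum>r\<in>{}. f r ij) = 0\<^sub>m n n" by (rule eq_matI) auto
  then show ?case by (simp add: mat_op_zero)
next
  case (insert r S)
  then have "mat n n (\<lambda>ij. \<Sum>r\<in>insert r S. f r ij) = mat n n (f r) + mat n n (\<lambda>ij. \<Sum>r\<in>S. f r ij)"
    by (intro eq_matI) auto
  then show ?case using insert by (simp add: mat_op_add)
qed

text \<open>Applying the operator to the \<open>j\<close>-th unit sequence and reading coordinate
  \<open>i < n\<close> recovers the entry \<open>(i, j)\<close> from the first block.\<close>

lemma mat_op_inject:
  assumes M: "M \<in> carrier_mat n n" and N: "N \<in> carrier_mat n n" and "mat_op n M = mat_op n N"
  shows "M = N"
proof (rule eq_matI)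
  fix i j assume "i < dim_row N" "j < dim_col N"
  then have ij: "i < n" "j < n" using N by auto
  have "(\<lambda>u i. \<Sum>s<n. M $$ (i mod n, s) * u (i div n * n + s)) =
      (\<lambda>u i. \<Sum>s<n. N $$ (i mod n, s) * u (i div n * n + s))"
    using arg_cong[OF assms(3), of Rep_lin_op] by (simp only: mat_op.rep_eq)
  from fun_cong[OF fun_cong[OF this, of "\<lambda>k. if k = j then 1 else 0"], of i]
  have "(\<Sum>s<n. M $$ (i, s) * (if s = j then 1 else 0)) = (\<Sum>s<n. N $$ (i, s) * (if s = j then 1 else 0))"
    using ij by simp
  then show "M $$ (i, j) = N $$ (i, j)" using ij by (simp add: if_distrib[where f = "(*) _"] cong: if_cong)
qed (use M N in auto)

end

section \<open>The dual algebra\<close>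

lemma const_1: "const (1::'a::field) = (1 :: 'm::monoid_add \<Rightarrow>\<^sub>0 'a)"
  by (simp add: const_def)

lemma ptensor_single:
  "a \<noteq> 0 \<Longrightarrow> b \<noteq> 0 \<Longrightarrow> ptensor (Poly_Mapping.single p a) (Poly_Mapping.single q b) = Poly_Mapping.single (p, q) (a * b)"
  by (simp add: ptensor_def)

lemma alg_eval_single:
  "alg_eval \<iota> u v w (Poly_Mapping.single (a, b, c) 1) = \<iota> 1 * u ^ a * v ^ b * w ^ c"
  by (simp add: alg_eval_def)

lemma counit_monomial: "counit (Poly_Mapping.single s (1::'a::field)) = (if s = 0 then 1 else 0)"
  by (cases s) (auto simp: counit_def alg_eval_single zero_prod_def)

lemma of_nat_mult_single:
  "of_nat k * Poly_Mapping.single m (c::'a::comm_ring_1) = Poly_Mapping.single (m::'m::comm_monoid_add) (of_nat k * c)"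
  by (metis add_0 mult_single single_of_nat)

text \<open>The binomial theorem is applied to the three coproducts, twice for \<open>z\<close>. The
  indices \<open>i\<close>, \<open>j\<close>, \<open>t\<close>, \<open>k\<close> count the factors
  \<open>x \<otimes> 1\<close>, \<open>y \<otimes> 1\<close>, \<open>x \<otimes> y\<close> and
  \<open>z \<otimes> 1\<close>.\<close>

lemma comult_monomial:
  "comult (Poly_Mapping.single (\<alpha>, \<beta>, \<gamma>) (1::'a::field)) =
    (\<Sum>i\<le>\<alpha>. \<Sum>j\<le>\<beta>. \<Sum>t\<le>\<gamma>. \<Sum>k\<le>\<gamma> - t.
      Poly_Mapping.single ((i + t, j, k), (\<alpha> - i, \<beta> - j + t, \<gamma> - t - k))
        (of_nat ((\<alpha> choose i) * (\<beta> choose j) * (\<gamma> choose t) * ((\<gamma> - t) choose k))))"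
proof -
  let ?s = "\<lambda>p q. Poly_Mapping.single (p, q) (1::'a) :: 'a coord_ring2"
  have pow: "?s (a, b, c) (a', b', c') ^ k = ?s (k * a, k * b, k * c) (k * a', k * b', k * c')" for a b c a' b' c' k
    by (induction k) (simp_all add: mult_single flip: single_one zero_prod_def)
  have x: "ptensor xvar 1 + ptensor 1 xvar = ?s (1, 0, 0) (0, 0, 0) + ?s (0, 0, 0) (1, 0, 0)"
    and y: "ptensor yvar 1 + ptensor 1 yvar = ?s (0, 1, 0) (0, 0, 0) + ?s (0, 0, 0) (0, 1, 0)"
    and z: "ptensor xvar yvar + (ptensor zvar 1 + ptensor 1 zvar) =
      ?s (1, 0, 0) (0, 1, 0) + (?s (0, 0, 1) (0, 0, 0) + ?s (0, 0, 0) (0, 0, 1))"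
    unfolding xvar_def yvar_def zvar_def single_one[symmetric] zero_prod_def
    by (simp_all add: ptensor_single)
  have "comult (Poly_Mapping.single (\<alpha>, \<beta>, \<gamma>) (1::'a)) =
      (ptensor xvar 1 + ptensor 1 xvar) ^ \<alpha> * (ptensor yvar 1 + ptensor 1 yvar) ^ \<beta>
        * (ptensor xvar yvar + (ptensor zvar 1 + ptensor 1 zvar)) ^ \<gamma>"
    unfolding comult_def alg_eval_single const_1 by (simp add: add.commute add.left_commute)
  also have "\<dots> =
    (\<Sum>i\<le>\<alpha>. \<Sum>j\<le>\<beta>. \<Sum>t\<le>\<gamma>. \<Sum>k\<le>\<gamma> - t.
      (of_nat (\<alpha> choose i) * ?s (i, 0, 0) (0, 0, 0) * ?s (0, 0, 0) (\<alpha> - i, 0, 0)) *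
      (of_nat (\<beta> choose j) * ?s (0, j, 0) (0, 0, 0) * ?s (0, 0, 0) (0, \<beta> - j, 0)) *
      (of_nat (\<gamma> choose t) * ?s (t, 0, 0) (0, t, 0) *
        (of_nat ((\<gamma> - t) choose k) * ?s (0, 0, k) (0, 0, 0) * ?s (0, 0, 0) (0, 0, \<gamma> - t - k))))"
  proof -
    have distrib: "sum f A * sum g B * (\<Sum>t\<in>C. \<Sum>k\<in>D t. h t k) =
        (\<Sum>i\<in>A. \<Sum>j\<in>B. \<Sum>t\<in>C. \<Sum>k\<in>D t. f i * g j * h t k)"
      for f g :: "nat \<Rightarrow> 'a coord_ring2" and h :: "nat \<Rightarrow> nat \<Rightarrow> 'a coord_ring2" and A B C D
      unfolding sum_product[of f A g B] unfolding sum_distrib_right unfolding sum_distrib_left ..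
    show ?thesis
      unfolding x y z binomial_ring pow mult_0_right mult_1_right sum_distrib_left[of _ _ "{..\<gamma> - _}"]
      by (rule distrib)
  qed
  also have "\<dots> = (\<Sum>i\<le>\<alpha>. \<Sum>j\<le>\<beta>. \<Sum>t\<le>\<gamma>. \<Sum>k\<le>\<gamma> - t.
      Poly_Mapping.single ((i + t, j, k), (\<alpha> - i, \<beta> - j + t, \<gamma> - t - k))
        (of_nat ((\<alpha> choose i) * (\<beta> choose j) * (\<gamma> choose t) * ((\<gamma> - t) choose k))))"
    by (intro sum.cong refl) (simp add: of_nat_mult_single mult_single mult.assoc)
  finally show ?thesis .
qed

text \<open>The coefficient of \<open>x\<^sup>a y\<^sup>b z\<^sup>c \<otimes> x\<^bsup>a'\<^esup> y\<^bsup>b'\<^esup> z\<^bsup>c'\<^esup>\<close> in the comultiplication of the monomial with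
  exponents \<open>a + a' - t\<close>, \<open>b + b' - t\<close>, \<open>c + c' + t\<close>; here \<open>t\<close> counts the factors \<open>x \<otimes> y\<close> taken from
  \<open>\<Delta>(z)\<close>.\<close>

definition dual_coeff :: "nat \<Rightarrow> nat \<Rightarrow> nat \<Rightarrow> nat \<Rightarrow> nat \<Rightarrow> nat \<Rightarrow> nat \<Rightarrow> nat" where
  "dual_coeff a b c a' b' c' t =
    ((a + a' - t) choose (a - t)) * ((b + b' - t) choose b) * ((c + c' + t) choose t) * ((c + c') choose c)"

text \<open>Once the pair of exponent triples is fixed, the number \<open>t\<close> of factors
  \<open>x \<otimes> y\<close> determines the other indices as \<open>a - t\<close>,
  \<open>b\<close>, \<open>c\<close>, and also the monomial \<open>s\<close>.\<close>

lemma lookup_comult_monomial: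
  "Poly_Mapping.lookup (comult (Poly_Mapping.single s (1::'a::field))) ((a, b, c), (a', b', c')) =
    (\<Sum>t\<le>min a b'. of_nat (dual_coeff a b c a' b' c' t) when s = (a + a' - t, b + b' - t, c + c' + t))"
proof -
  obtain \<alpha> \<beta> \<gamma> where s: "s = (\<alpha>, \<beta>, \<gamma>)" by (cases s)
  let ?S = "{..\<alpha>} \<times> {..\<beta>} \<times> (SIGMA t:{..\<gamma>}. {..\<gamma> - t})"
  let ?f = "\<lambda>(i, j, t, k). of_nat ((\<alpha> choose i) * (\<beta> choose j) * (\<gamma> choose t) * ((\<gamma> - t) choose k)) :: 'a"
  let ?k = "\<lambda>(i, j, t, k). ((i + t, j, k), (\<alpha> - i, \<beta> - j + t, \<gamma> - t - k)) = ((a, b, c), (a', b', c'))"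
  have "Poly_Mapping.lookup (comult (Poly_Mapping.single s (1::'a))) ((a, b, c), (a', b', c')) =
      (\<Sum>x\<in>?S. if ?k x then ?f x else 0)"
  proof -
    have "(\<Sum>i\<le>\<alpha>. \<Sum>j\<le>\<beta>. \<Sum>t\<le>\<gamma>. \<Sum>k\<le>\<gamma> - t. F i j t k) = (\<Sum>(i, j, t, k)\<in>?S. F i j t k)"
      for F :: "nat \<Rightarrow> nat \<Rightarrow> nat \<Rightarrow> nat \<Rightarrow> 'a"
      by (simp add: sum.cartesian_product sum.Sigma split_def)
    then show ?thesis
      unfolding s comult_monomial lookup_sum lookup_single when_def by (auto intro: sum.cong)
  qed
  also have "\<dots> = (\<Sum>x | x \<in> ?S \<and> ?k x. ?f x)"
    by (rule sum.inter_filter[symmetric]) auto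
  also have "\<dots> = (\<Sum>t | t \<in> {..min a b'} \<and> s = (a + a' - t, b + b' - t, c + c' + t).
      of_nat (dual_coeff a b c a' b' c' t))"
    by (rule sum.reindex_bij_witness[of _ "\<lambda>t. (a - t, b, t, c)" "\<lambda>(i, j, t, k). t"])
      (auto simp: s dual_coeff_def)
  also have "\<dots> = (\<Sum>t\<le>min a b'. of_nat (dual_coeff a b c a' b' c' t) when s = (a + a' - t, b + b' - t, c + c' + t))"
    unfolding when_def by (rule sum.inter_filter) auto
  finally show ?thesis .
qed


section \<open>The comodule axioms in coordinates\<close>

lemma lookup_vtensor:
  assumes "vector_space scale"
  shows "Poly_Mapping.lookup (vtensor scale v f) q = scale (Poly_Mapping.lookup f q) v"
proof -
  interpret vector_space scale by fact
  have "Poly_Mapping.lookup (vtensor scale v f) q =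
      (\<Sum>q'\<in>Poly_Mapping.keys f. if q' = q then scale (Poly_Mapping.lookup f q') v else 0)"
    by (simp add: vtensor_def lookup_sum lookup_single when_def)
  also have "\<dots> = scale (Poly_Mapping.lookup f q) v"
    by (auto simp: sum.delta in_keys_iff)
  finally show ?thesis .
qed

lemma lookup_id_tensor_comult:
  assumes "vector_space scale"
  shows "Poly_Mapping.lookup (id_tensor_comult scale t) P = (\<Sum>s\<in>Poly_Mapping.keys t.
    scale (Poly_Mapping.lookup (comult (Poly_Mapping.single s 1)) P) (Poly_Mapping.lookup t s))"
  by (simp add: id_tensor_comult_def lookup_sum lookup_vtensor[OF assms])

lemma lookup_coact_tensor_id:
  assumes "\<rho> 0 = 0"
  shows "Poly_Mapping.lookup (coact_tensor_id \<rho> t) (p, q) =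
    Poly_Mapping.lookup (\<rho> (Poly_Mapping.lookup t q)) p"
proof -
  have *: "(\<Sum>p'\<in>Poly_Mapping.keys f. if p' = p \<and> q' = q then Poly_Mapping.lookup f p' else 0) =
      (if q' = q then Poly_Mapping.lookup f p else 0)" for f :: "mon \<Rightarrow>\<^sub>0 'a" and q'
    by (cases "q' = q") (auto simp: sum.delta in_keys_iff)
  have "Poly_Mapping.lookup (coact_tensor_id \<rho> t) (p, q) = (\<Sum>q'\<in>Poly_Mapping.keys t.
      if q' = q then Poly_Mapping.lookup (\<rho> (Poly_Mapping.lookup t q')) p else 0)"
    by (simp add: coact_tensor_id_def lookup_sum lookup_single when_def *)
  also have "\<dots> = Poly_Mapping.lookup (\<rho> (Poly_Mapping.lookup t q)) p"
    by (auto simp: sum.delta in_keys_iff assms)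
  finally show ?thesis .
qed

locale heisenberg_matrix_rep = vector_space scale
  for scale :: "'a::field \<Rightarrow> 'v::ab_group_add \<Rightarrow> 'v" +
  fixes \<rho> :: "'v \<Rightarrow> (mon \<Rightarrow>\<^sub>0 'v)" and n :: nat and e :: "nat \<Rightarrow> 'v" and A :: "'a coord_ring mat"
  assumes rep: "heisenberg_rep scale \<rho>" and basis: "ordered_basis scale n e"
    and formula: "matrix_formula scale n e \<rho> A"
begin

definition coeff :: "mon \<Rightarrow> nat \<Rightarrow> nat \<Rightarrow> 'a" where
  "coeff p i j = Poly_Mapping.lookup (A $$ (i, j)) p"

lemma basis_coeffs_unique:
  assumes "(\<Sum>i<n. scale (f i) (e i)) = (\<Sum>i<n. scale (g i) (e i))" and "l < n"
  shows "f l = g l"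
proof (rule ccontr)
  assume ne: "f l \<noteq> g l"
  have inj: "inj_on e {..<n}" and ind: "independent (e ` {..<n})"
    using basis by (auto simp: ordered_basis_def)
  define u where "u v = f (inv_into {..<n} e v) - g (inv_into {..<n} e v)" for v
  have u: "u (e i) = f i - g i" if "i < n" for i
    using that inj by (simp add: u_def inv_into_f_f)
  have "(\<Sum>v\<in>e ` {..<n}. scale (u v) v) = (\<Sum>i<n. scale (u (e i)) (e i))"
    using inj by (simp add: sum.reindex)
  also have "\<dots> = (\<Sum>i<n. scale (f i) (e i) - scale (g i) (e i))"
    by (rule sum.cong) (auto simp: u scale_left_diff_distrib)
  also have "\<dots> = 0" using assms by (simp add: sum_subtractf)
  finally have "(\<Sum>v\<in>e ` {..<n}. scale (u v) v) = 0" .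
  moreover have "u (e l) \<noteq> 0" using ne u[OF assms(2)] by simp
  ultimately have "\<exists>u. (\<exists>v\<in>e ` {..<n}. u v \<noteq> 0) \<and> (\<Sum>v\<in>e ` {..<n}. scale (u v) v) = 0"
    using assms(2) by blast
  then have "dependent (e ` {..<n})"
    by (simp only: dependent_finite[OF finite_imageI[OF finite_lessThan]])
  then show False using ind by simp
qed

lemma lookup_coaction_basis:
  assumes "j < n"
  shows "Poly_Mapping.lookup (\<rho> (e j)) p = (\<Sum>i<n. scale (coeff p i j) (e i))"
  using formula assms
  by (simp add: matrix_formula_def lookup_sum lookup_vtensor[OF vector_space_axioms] coeff_def)

lemma coaction_linear:
  "\<rho> (v + w) = \<rho> v + \<rho> w" "Poly_Mapping.lookup (\<rho> (scale c v)) p = scale c (Poly_Mapping.lookup (\<rho> v) p)"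
proof -
  interpret L: Vector_Spaces.linear scale "\<lambda>c. Poly_Mapping.map (scale c)" \<rho>
    using rep by (simp add: heisenberg_rep_def)
  show "\<rho> (v + w) = \<rho> v + \<rho> w" by (rule L.add)
  show "Poly_Mapping.lookup (\<rho> (scale c v)) p = scale c (Poly_Mapping.lookup (\<rho> v) p)"
    by (simp add: L.scale map.rep_eq when_def)
qed

lemma coaction_0: "\<rho> 0 = 0"
  using coaction_linear(1)[of 0 0] by simp

lemma lookup_coaction_sum:
  "Poly_Mapping.lookup (\<rho> (\<Sum>i\<in>S. scale (f i) (v i))) p = (\<Sum>i\<in>S. scale (f i) (Poly_Mapping.lookup (\<rho> (v i)) p))"
  by (induction S rule: infinite_finite_induct)
    (simp_all add: coaction_0 coaction_linear lookup_add)

text \<open>Coassociativity at \<open>e j\<close>, compared at one pair of monomials and one basis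
  vector: the left side is a matrix product, the right side the multiplication of the dual
  algebra.\<close>

lemma coeff_mult:
  assumes l: "l < n" and j: "j < n"
  shows "(\<Sum>i<n. coeff (a, b, c) l i * coeff (a', b', c') i j) =
    (\<Sum>t\<le>min a b'. of_nat (dual_coeff a b c a' b' c' t) * coeff (a + a' - t, b + b' - t, c + c' + t) l j)"
proof (rule basis_coeffs_unique[OF _ l])
  let ?P = "((a, b, c), (a', b', c'))"
  let ?d = "\<lambda>t. of_nat (dual_coeff a b c a' b' c' t) :: 'a"
  let ?s = "\<lambda>t. (a + a' - t, b + b' - t, c + c' + t)"
  let ?K = "Poly_Mapping.keys (\<rho> (e j))"
  let ?r = "Poly_Mapping.lookup (\<rho> (e j))"
  have "(\<Sum>l<n. scale (\<Sum>i<n. coeff (a, b, c) l i * coeff (a', b', c') i j) (e l)) =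
      (\<Sum>l<n. \<Sum>i<n. scale (coeff (a', b', c') i j) (scale (coeff (a, b, c) l i) (e l)))"
    by (simp add: scale_sum_left mult.commute)
  also have "\<dots> = (\<Sum>i<n. scale (coeff (a', b', c') i j) (\<Sum>l<n. scale (coeff (a, b, c) l i) (e l)))"
    by (subst sum.swap) (simp add: scale_sum_right)
  also have "\<dots> = Poly_Mapping.lookup (\<rho> (?r (a', b', c'))) (a, b, c)"
    by (simp add: lookup_coaction_basis j lookup_coaction_sum)
  also have "\<dots> = Poly_Mapping.lookup (coact_tensor_id \<rho> (\<rho> (e j))) ?P"
    by (simp add: lookup_coact_tensor_id coaction_0)
  also have "\<dots> = Poly_Mapping.lookup (id_tensor_comult scale (\<rho> (e j))) ?P"
    using rep by (simp add: heisenberg_rep_def)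
  also have "\<dots> = (\<Sum>s\<in>?K. scale (\<Sum>t\<le>min a b'. ?d t when s = ?s t) (?r s))"
    by (simp only: lookup_id_tensor_comult[OF vector_space_axioms] lookup_comult_monomial)
  also have "\<dots> = (\<Sum>t\<le>min a b'. \<Sum>s\<in>?K. if s = ?s t then scale (?d t) (?r s) else 0)"
    unfolding scale_sum_left by (subst sum.swap) (auto intro!: sum.cong simp: when_def)
  also have "\<dots> = (\<Sum>t\<le>min a b'. scale (?d t) (?r (?s t)))"
    by (intro sum.cong refl) (auto simp: sum.delta in_keys_iff)
  also have "\<dots> = (\<Sum>t\<le>min a b'. \<Sum>l<n. scale (?d t * coeff (?s t) l j) (e l))"
    by (simp add: lookup_coaction_basis j scale_sum_right)
  also have "\<dots> = (\<Sum>l<n. scale (\<Sum>t\<le>min a b'. ?d t * coeff (?s t) l j) (e l))"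
    by (subst sum.swap) (simp add: scale_sum_left)
  finally show "(\<Sum>l<n. scale (\<Sum>i<n. coeff (a, b, c) l i * coeff (a', b', c') i j) (e l)) =
    (\<Sum>l<n. scale (\<Sum>t\<le>min a b'. ?d t * coeff (?s t) l j) (e l))" .
qed

lemma coeff_0:
  assumes l: "l < n" and j: "j < n"
  shows "coeff (0, 0, 0) l j = (if l = j then 1 else 0)"
proof (rule basis_coeffs_unique[OF _ l])
  let ?r = "Poly_Mapping.lookup (\<rho> (e j))"
  have "(\<Sum>i<n. scale (coeff (0, 0, 0) i j) (e i)) = ?r 0"
    by (simp add: lookup_coaction_basis j zero_prod_def)
  also have "\<dots> = (\<Sum>q\<in>Poly_Mapping.keys (\<rho> (e j)). if q = 0 then ?r q else 0)"
    by (auto simp: sum.delta in_keys_iff)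
  also have "\<dots> = id_tensor_counit scale (\<rho> (e j))"
    unfolding id_tensor_counit_def by (rule sum.cong) (auto simp: counit_monomial)
  also have "\<dots> = e j" using rep by (simp add: heisenberg_rep_def)
  also have "\<dots> = (\<Sum>i<n. if i = j then e i else 0)" using j by simp
  also have "\<dots> = (\<Sum>i<n. scale (if i = j then 1 else 0) (e i))"
    by (rule sum.cong) auto
  finally show "(\<Sum>i<n. scale (coeff (0, 0, 0) i j) (e i)) = (\<Sum>i<n. scale (if i = j then 1 else 0) (e i))" .
qed

end

section \<open>Matrix formulas in the endomorphism ring\<close>

interpretation const: inj_comm_ring_hom "const :: 'a::field \<Rightarrow> ('m::comm_monoid_add \<Rightarrow>\<^sub>0 'a)"
proof
  fix x y :: 'a
  show "const (x + y) = const x + (const y :: 'm \<Rightarrow>\<^sub>0 'a)" by (simp add: const_def single_add)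
  show "const (x * y) = const x * (const y :: 'm \<Rightarrow>\<^sub>0 'a)" by (simp add: const_def mult_single)
  show "const x = (0 :: 'm \<Rightarrow>\<^sub>0 'a) \<Longrightarrow> x = 0" unfolding const_def by (metis lookup_single_eq lookup_zero)
qed (simp_all add: const_def)

lemma exp_scalars_op_scalar:
  assumes "\<And>k. k < q \<Longrightarrow> of_nat (fact k) \<noteq> (0::'a::field)"
  shows "exp_scalars op_scalar (\<lambda>k. const (1 / of_nat (fact k)) :: 'a coord_ring) q"
proof
  fix k assume "k < q"
  have "of_nat (fact k) = (const (of_nat (fact k)) :: 'a coord_ring)"
    by (simp only: const_def single_of_nat)
  then show "const (1 / of_nat (fact k)) * of_nat (fact k) = (1 :: 'a coord_ring)"
    using assms[OF \<open>k < q\<close>] by (simp flip: const.hom_mult)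
qed (fact op_scalar_add op_scalar_mult op_scalar_1 op_scalar_central)+

definition const_op :: "nat \<Rightarrow> 'a::field mat \<Rightarrow> 'a coord_ring lin_op" where
  "const_op n M = mat_op n (map_mat const M)"

context
  fixes n :: nat
  assumes n: "n > 0"
begin

lemma const_op_mult:
  "M \<in> carrier_mat n n \<Longrightarrow> N \<in> carrier_mat n n \<Longrightarrow> const_op n (M * N) = const_op n M * const_op n N"
  unfolding const_op_def by (simp add: const.mat_hom_mult[of _ n n _ n] mat_op_mult[OF n])

lemma const_op_minus:
  "M \<in> carrier_mat n n \<Longrightarrow> N \<in> carrier_mat n n \<Longrightarrow> const_op n (M - N) = const_op n M - const_op n N"
  unfolding const_op_def
  by (subst mat_op_minus[OF n, symmetric]) (auto intro!: arg_cong[of _ _ "mat_op n"] eq_matI simp: const.hom_minus)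

lemma const_op_power: "M \<in> carrier_mat n n \<Longrightarrow> const_op n (M ^\<^sub>m k) = const_op n M ^ k"
  unfolding const_op_def by (simp add: const.mat_hom_pow[of _ n] mat_op_power[OF n])

lemma const_op_zero: "const_op n (0\<^sub>m n n) = 0"
  unfolding const_op_def
  by (subst mat_op_zero[OF n, symmetric]) (auto intro!: arg_cong[of _ _ "mat_op n"] eq_matI)

lemma const_op_one: "const_op n (1\<^sub>m n) = 1"
  unfolding const_op_def by (simp add: const.mat_hom_one mat_op_one[OF n])

lemma const_op_inject:
  assumes "M \<in> carrier_mat n n" "N \<in> carrier_mat n n" "const_op n M = const_op n N"
  shows "M = N"
proof -
  have "map_mat const M = (map_mat const N :: _ coord_ring mat)"
    using assms by (intro mat_op_inject[OF n]) (simp_all add: const_op_def)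
  then show ?thesis by (rule const.mat_hom_inj)
qed

lemma heisenberg_tripleI:
  assumes c: "X \<in> carrier_mat n n" "Y \<in> carrier_mat n n" "Z \<in> carrier_mat n n"
    and nil: "const_op n X ^ k = 0" "const_op n Y ^ k = 0" "const_op n Z ^ k = 0"
    and comm: "const_op n X * const_op n Y = const_op n Y * const_op n X + const_op n Z"
      "const_op n Z * const_op n X = const_op n X * const_op n Z"
      "const_op n Z * const_op n Y = const_op n Y * const_op n Z"
  shows "heisenberg_triple n X Y Z"
proof -
  have "nilpotent_mat n M" if "M \<in> carrier_mat n n" "const_op n M ^ k = 0" for M :: "'a mat"
  proof -
    have "M ^\<^sub>m k = 0\<^sub>m n n"
      by (rule const_op_inject) (use that in \<open>simp_all add: const_op_power const_op_zero\<close>)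
    then show ?thesis using that by (auto simp: nilpotent_mat_def)
  qed
  moreover have "Z = commutator_mat X Y" "commutator_mat X Z = 0\<^sub>m n n" "commutator_mat Y Z = 0\<^sub>m n n"
    by (rule const_op_inject; use c comm in \<open>simp add: commutator_mat_def const_op_minus const_op_mult const_op_zero minus_carrier_mat mult_carrier_mat[of _ n n]\<close>)+
  ultimately show ?thesis using c nil by (simp add: heisenberg_triple_def)
qed

lemma mat_op_foldr:
  assumes "\<And>i. i \<in> set is \<Longrightarrow> F i \<in> carrier_mat n n"
  shows "foldr (\<lambda>i B. F i * B) is (1\<^sub>m n) \<in> carrier_mat n n"
    and "mat_op n (foldr (\<lambda>i B. F i * B) is (1\<^sub>m n)) = foldr (\<lambda>i B. mat_op n (F i) * B) is 1"
  using assms by (induction "is") (auto simp: mat_op_one[OF n] mat_op_mult[OF n] intro!: mult_carrier_mat)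

text \<open>\<open>mat_exp\<close> sums over the nonzero powers, \<open>exp_sum\<close> over all
  degrees below \<open>4 * n\<close>. The two agree because the powers of the exponent vanish from
  \<open>4 * n\<close> on and omitted terms are 0.\<close>

lemma mat_op_heisenberg_exp:
  fixes X Y Z :: "'a::field mat"
  assumes c: "X \<in> carrier_mat n n" "Y \<in> carrier_mat n n" "Z \<in> carrier_mat n n"
    and nil: "const_op n X ^ n = 0" "const_op n Y ^ n = 0" "const_op n Z ^ n = 0"
    and comm: "const_op n X * const_op n Y = const_op n Y * const_op n X + const_op n Z"
      "const_op n Z * const_op n X = const_op n X * const_op n Z"
      "const_op n Z * const_op n Y = const_op n Y * const_op n Z"
    and "exp_scalars op_scalar (\<lambda>k. const (1 / of_nat (fact k)) :: 'a coord_ring) q" and q: "4 * n \<le> q"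
  shows "mat_op n (heisenberg_exp n u v w X Y Z) =
    exp_scalars.exp_sum op_scalar (\<lambda>k. const (1 / of_nat (fact k))) n u v w
      (const_op n X) (const_op n Y) (const_op n Z)"
proof -
  interpret exp_scalars op_scalar "\<lambda>k. const (1 / of_nat (fact k)) :: 'a coord_ring" q by fact
  define N where "N = u \<cdot>\<^sub>m map_mat const X + v \<cdot>\<^sub>m map_mat const Y
    + (w - const (1 / 2) * (u * v)) \<cdot>\<^sub>m map_mat const Z"
  define E where "E = op_scalar u * const_op n X + op_scalar v * const_op n Y
    + op_scalar (w - const (1 / 2) * (u * v)) * const_op n Z"
  have N: "N \<in> carrier_mat n n" using c by (simp add: N_def)
  have "mat_op n N = E"
    using c by (simp add: N_def E_def const_op_def mat_op_add[OF n] mat_op_smult[OF n])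
  then have pow: "mat_op n (N ^\<^sub>m k) = E ^ k" for k
    by (simp add: mat_op_power[OF n N])
  have nilE: "E ^ k = 0" if "k \<ge> 4 * n" for k
    using exp_heisenberg(1)[OF comm nil q n that, of u v w] by (simp add: E_def)
  have iff: "N ^\<^sub>m k = 0\<^sub>m n n \<longleftrightarrow> E ^ k = 0" for k
    using mat_op_inject[OF n, of "N ^\<^sub>m k" "0\<^sub>m n n"] N pow[of k] by (auto simp: mat_op_zero[OF n])
  have S: "{r. N ^\<^sub>m r \<noteq> 0\<^sub>m n n} \<subseteq> {..<4 * n}"
    using nilE by (auto simp: iff not_less[symmetric])
  then have fin: "finite {r. N ^\<^sub>m r \<noteq> 0\<^sub>m n n}" using finite_subset by blast
  have "mat_op n (mat_exp n N) = mat_op n (mat n n (\<lambda>ij. \<Sum>r | N ^\<^sub>m r \<noteq> 0\<^sub>m n n.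
      const (1 / of_nat (fact r)) * (N ^\<^sub>m r) $$ ij))"
    unfolding mat_exp_def by (rule arg_cong[of _ _ "mat_op n"]) (auto intro!: eq_matI)
  also have "\<dots> = (\<Sum>r | N ^\<^sub>m r \<noteq> 0\<^sub>m n n. mat_op n (const (1 / of_nat (fact r)) \<cdot>\<^sub>m (N ^\<^sub>m r)))"
    unfolding mat_op_sum[OF n fin]
    by (intro sum.cong refl arg_cong[of _ _ "mat_op n"] eq_matI)
      (use carrier_matD[OF pow_carrier_mat[OF N]] in auto)
  also have "\<dots> = (\<Sum>r | N ^\<^sub>m r \<noteq> 0\<^sub>m n n. divided_power E r)"
    using N by (simp add: mat_op_smult[OF n] pow divided_power_def)
  also have "\<dots> = (\<Sum>r<4 * n. divided_power E r)"
    by (rule sum.mono_neutral_left) (use S in \<open>auto simp: iff divided_power_def\<close>)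
  finally show ?thesis
    unfolding heisenberg_exp_def exp_sum_def N_def[symmetric] by (simp add: E_def)
qed

end

section \<open>The coefficient matrices as a Heisenberg sequence\<close>

context heisenberg_matrix_rep
begin

definition coeff_mat :: "mon \<Rightarrow> 'a mat" where
  "coeff_mat p = mat n n (\<lambda>(i, j). coeff p i j)"

definition coeff_op :: "mon \<Rightarrow> 'a coord_ring lin_op" where
  "coeff_op p = const_op n (coeff_mat p)"

lemma coeff_mat_carrier [simp]: "coeff_mat p \<in> carrier_mat n n"
  by (simp add: coeff_mat_def)

lemma coeff_bounded: "\<exists>D. \<forall>a b c. (a \<ge> D \<or> b \<ge> D \<or> c \<ge> D) \<longrightarrow> (\<forall>i<n. \<forall>j<n. coeff (a, b, c) i j = 0)"
proof -
  define F where "F = (\<Union>i<n. \<Union>j<n. Poly_Mapping.keys (A $$ (i, j)))"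
  \<comment> \<open>The sum of all total degrees is a crude bound for each exponent of each monomial
    that occurs.\<close>
  define f where "f = (\<lambda>(a, b, c). a + b + c :: nat)"
  have F: "finite F" by (simp add: F_def)
  have "coeff (a, b, c) i j = 0" if "a \<ge> Suc (sum f F) \<or> b \<ge> Suc (sum f F) \<or> c \<ge> Suc (sum f F)" "i < n" "j < n"
    for a b c i j
  proof (rule ccontr)
    assume "coeff (a, b, c) i j \<noteq> 0"
    then have "(a, b, c) \<in> F" using that by (auto simp: F_def coeff_def in_keys_iff)
    then have "f (a, b, c) \<le> sum f F" using F by (intro member_le_sum) auto
    then show False using that by (auto simp: f_def)
  qed
  then show ?thesis by blast
qed

context
  assumes n: "n > 0"
begin

lemma coeff_op_mult:
  "coeff_op (a, b, c) * coeff_op (a', b', c') =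
    (\<Sum>t\<le>min a b'. of_nat (dual_coeff a b c a' b' c' t) * coeff_op (a + a' - t, b + b' - t, c + c' + t))"
proof -
  let ?s = "\<lambda>t. (a + a' - t, b + b' - t, c + c' + t)"
  let ?d = "dual_coeff a b c a' b' c'"
  have of_nat: "(of_nat k :: 'a coord_ring lin_op) = op_scalar (const (of_nat k))" for k
  proof -
    have "op_scalar (of_nat k) = (of_nat k :: 'a coord_ring lin_op)"
      by (induction k) (simp_all add: op_scalar_add op_scalar_1 op_scalar_0)
    then show ?thesis by (simp add: const_def)
  qed
  have "coeff_mat (a, b, c) * coeff_mat (a', b', c') =
      mat n n (\<lambda>(i, j). \<Sum>t\<le>min a b'. of_nat (?d t) * coeff (?s t) i j)"
    by (rule eq_matI)
      (auto simp: coeff_mat_def scalar_prod_def atLeast0LessThan coeff_mult[symmetric])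
  then have "map_mat const (coeff_mat (a, b, c) * coeff_mat (a', b', c')) =
      (mat n n (\<lambda>ij. \<Sum>t\<le>min a b'. const (of_nat (?d t)) * const (coeff_mat (?s t) $$ ij)) :: 'a coord_ring mat)"
    by (auto simp: coeff_mat_def const.hom_sum const.hom_mult intro!: eq_matI)
  then have "const_op n (coeff_mat (a, b, c) * coeff_mat (a', b', c')) = (\<Sum>t\<le>min a b'.
      mat_op n (mat n n (\<lambda>ij. const (of_nat (?d t)) * const (coeff_mat (?s t) $$ ij))))"
    unfolding const_op_def by (simp only: mat_op_sum[OF n] finite_atMost)
  also have "\<dots> = (\<Sum>t\<le>min a b'. of_nat (?d t) * coeff_op (?s t))"
  proof (rule sum.cong[OF refl])
    fix t
    have "mat n n (\<lambda>ij. const (of_nat (?d t)) * const (coeff_mat (?s t) $$ ij)) =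
        const (of_nat (?d t)) \<cdot>\<^sub>m (map_mat const (coeff_mat (?s t)) :: 'a coord_ring mat)"
      by (rule eq_matI) (auto simp: coeff_mat_def)
    then show "mat_op n (mat n n (\<lambda>ij. const (of_nat (?d t)) * const (coeff_mat (?s t) $$ ij))) =
        of_nat (?d t) * coeff_op (?s t)"
      by (simp only: mat_op_smult[OF n] map_carrier_mat coeff_mat_carrier coeff_op_def const_op_def of_nat)
  qed
  finally show ?thesis
    by (simp only: coeff_op_def const_op_mult[OF n] coeff_mat_carrier)
qed

lemma coeff_op_0: "coeff_op (0, 0, 0) = 1"
proof -
  have "coeff_mat (0, 0, 0) = 1\<^sub>m n" by (rule eq_matI) (auto simp: coeff_mat_def coeff_0)
  then show ?thesis by (simp add: coeff_op_def const_op_one[OF n])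
qed

lemma coeff_op_eq_0: "(\<And>i j. i < n \<Longrightarrow> j < n \<Longrightarrow> coeff p i j = 0) \<Longrightarrow> coeff_op p = 0"
proof -
  assume "\<And>i j. i < n \<Longrightarrow> j < n \<Longrightarrow> coeff p i j = 0"
  then have "coeff_mat p = 0\<^sub>m n n" by (intro eq_matI) (auto simp: coeff_mat_def)
  then show ?thesis by (simp add: coeff_op_def const_op_zero[OF n])
qed

text \<open>In the order y, x, z only \<open>t = 0\<close> is possible in both products, and the
  coefficient is 1. With x before y, factors \<open>x \<otimes> y\<close> would add further
  terms.\<close>

lemma coeff_op_factor: "coeff_op (a, b, c) = coeff_op (0, b, 0) * coeff_op (a, 0, 0) * coeff_op (0, 0, c)"
  by (simp add: coeff_op_mult dual_coeff_def)

text \<open>\<open>f a ^ k\<close> is an integer multiple of \<open>f (k * a)\<close>, which is 0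
  for large \<open>k\<close> as the entries are polynomials. The bound by the dimension then gives
  the exponent \<open>n\<close>. No factorial is inverted, so the argument is valid in every
  characteristic.\<close>

lemma coeff_op_nilpotent:
  assumes f: "f 0 = 1" "\<And>i j. f i * f j = of_nat ((i + j) choose i) * f (i + j)"
    and D: "\<And>i. i \<ge> D \<Longrightarrow> f i = 0" and g: "\<And>i. f i = const_op n (g i)" "\<And>i. g i \<in> carrier_mat n n"
    and a: "a > 0"
  shows "f a ^ n = 0"
proof -
  have "\<exists>c. f a ^ k = of_nat c * f (k * a)" for k
  proof (induction k)
    case (Suc k)
    then obtain c where "f a ^ k = of_nat c * f (k * a)" ..
    then have "f a ^ Suc k = of_nat c * (f (k * a) * f a)" by (simp only: power_Suc2 mult.assoc)
    then have "f a ^ Suc k = of_nat (c * ((k * a + a) choose (k * a))) * f (Suc k * a)"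
      by (simp add: f mult.assoc add.commute)
    then show ?case ..
  qed (use f in \<open>auto intro: exI[of _ 1]\<close>)
  then obtain c where "f a ^ D = of_nat c * f (D * a)" by blast
  moreover have "D * a \<ge> D" using a by simp
  ultimately have "f a ^ D = 0" using D by simp
  then have "g a ^\<^sub>m D = 0\<^sub>m n n"
    using g by (intro const_op_inject[OF n]) (simp_all add: const_op_power[OF n] const_op_zero[OF n])
  then have "g a ^\<^sub>m n = 0\<^sub>m n n" by (rule nilpotent_mat_power_dim[OF g(2)])
  then show ?thesis using g by (metis const_op_power[OF n] const_op_zero[OF n])
qed

lemma heisenberg_seq_coeff_op:
  "heisenberg_seq n (\<lambda>a. coeff_op (a, 0, 0)) (\<lambda>b. coeff_op (0, b, 0)) (\<lambda>c. coeff_op (0, 0, c))"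
proof -
  have div: "coeff_op (i, 0, 0) * coeff_op (j, 0, 0) = of_nat ((i + j) choose i) * coeff_op (i + j, 0, 0)"
    "coeff_op (0, i, 0) * coeff_op (0, j, 0) = of_nat ((i + j) choose i) * coeff_op (0, i + j, 0)"
    "coeff_op (0, 0, i) * coeff_op (0, 0, j) = of_nat ((i + j) choose i) * coeff_op (0, 0, i + j)" for i j
    by (simp_all add: coeff_op_mult dual_coeff_def)
  obtain D where D: "\<And>a b c i j. a \<ge> D \<or> b \<ge> D \<or> c \<ge> D \<Longrightarrow> i < n \<Longrightarrow> j < n \<Longrightarrow> coeff (a, b, c) i j = 0"
    using coeff_bounded by blast
  have nil: "coeff_op (a, 0, 0) ^ n = 0" "coeff_op (0, a, 0) ^ n = 0" "coeff_op (0, 0, a) ^ n = 0" if "a > 0" for a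
    by (rule coeff_op_nilpotent[where D = D, OF _ _ _ _ _ that] |
      rule coeff_op_0 div coeff_op_eq_0 coeff_op_def coeff_mat_carrier | simp add: D)+
  show ?thesis
  proof
    fix i j
    show "coeff_op (i, 0, 0) * coeff_op (0, j, 0) =
        (\<Sum>t\<le>min i j. coeff_op (0, j - t, 0) * coeff_op (i - t, 0, 0) * coeff_op (0, 0, t))"
      \<comment> \<open>Each summand becomes the single element
        \<open>coeff_op (i - t, j - t, t)\<close>, and all dual coefficients in this product equal
        1.\<close>
      unfolding coeff_op_factor[symmetric]
      by (simp add: coeff_op_mult dual_coeff_def)
    show "coeff_op (0, 0, i) * coeff_op (j, 0, 0) = coeff_op (j, 0, 0) * coeff_op (0, 0, i)"
      "coeff_op (0, 0, i) * coeff_op (0, j, 0) = coeff_op (0, j, 0) * coeff_op (0, 0, i)"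
      by (simp_all add: coeff_op_mult dual_coeff_def)
  qed (fact coeff_op_0 div nil)+
qed

end

end

lemma monomial_eq:
  "yvar ^ b * xvar ^ a * zvar ^ c = (Poly_Mapping.single (a, b, c) 1 :: 'a::field coord_ring)"
proof -
  have "xvar ^ k = (Poly_Mapping.single (k, 0, 0) 1 :: 'a coord_ring)"
    "yvar ^ k = (Poly_Mapping.single (0, k, 0) 1 :: 'a coord_ring)"
    "zvar ^ k = (Poly_Mapping.single (0, 0, k) 1 :: 'a coord_ring)" for k
    unfolding xvar_def yvar_def zvar_def
    by (induction k) (simp_all add: mult_single flip: single_one zero_prod_def)
  then show ?thesis by (simp add: mult_single)
qed

section \<open>The exponential formulas in both characteristics\<close>

context heisenberg_matrix_rep
begin

context
  assumes n: "n > 0"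
begin

text \<open>The formula is expanded over the cube of exponents below \<open>L\<close>. Monomials and
  coefficient matrices both factor in the order y, x, z, so the sum becomes a product of three
  sums.\<close>

lemma mat_op_matrix:
  assumes es: "exp_scalars op_scalar (\<phi> :: nat \<Rightarrow> 'a coord_ring) q"
    and L: "\<And>a b c i j. a \<ge> L \<or> b \<ge> L \<or> c \<ge> L \<Longrightarrow> i < n \<Longrightarrow> j < n \<Longrightarrow> coeff (a, b, c) i j = 0"
  shows "mat_op n A = exp_scalars.coord_sum op_scalar (\<lambda>a. coeff_op (a, 0, 0)) (\<lambda>b. coeff_op (0, b, 0))
    (\<lambda>c. coeff_op (0, 0, c)) L xvar yvar zvar"
proof -
  interpret exp_scalars op_scalar \<phi> q by fact
  let ?B = "{..<L} \<times> {..<L} \<times> {..<L}"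
  let ?m = "\<lambda>p. Poly_Mapping.single p 1 :: 'a coord_ring"
  have A: "A \<in> carrier_mat n n" using formula by (simp add: matrix_formula_def)
  have "A = mat n n (\<lambda>ij. \<Sum>p\<in>?B. ?m p * const (coeff_mat p $$ ij))"
  proof (rule eq_matI)
    fix i j assume "i < dim_row (mat n n (\<lambda>ij. \<Sum>p\<in>?B. ?m p * const (coeff_mat p $$ ij)))"
      "j < dim_col (mat n n (\<lambda>ij. \<Sum>p\<in>?B. ?m p * const (coeff_mat p $$ ij)))"
    then have ij: "i < n" "j < n" by auto
    have "A $$ (i, j) = (\<Sum>p\<in>?B. Poly_Mapping.single p (coeff p i j))"
    proof (rule poly_mapping_eqI)
      fix s :: mon
      have "coeff s i j = 0" if "s \<notin> ?B" using that L[OF _ ij] by (cases s) (auto simp: not_less)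
      then show "Poly_Mapping.lookup (A $$ (i, j)) s = Poly_Mapping.lookup (\<Sum>p\<in>?B. Poly_Mapping.single p (coeff p i j)) s"
        by (auto simp: lookup_sum lookup_single when_def coeff_def)
    qed
    then show "A $$ (i, j) = mat n n (\<lambda>ij. \<Sum>p\<in>?B. ?m p * const (coeff_mat p $$ ij)) $$ (i, j)"
      using ij by (simp add: coeff_mat_def const_def mult_single)
  qed (use A in auto)
  then have "mat_op n A = (\<Sum>p\<in>?B. mat_op n (mat n n (\<lambda>ij. ?m p * const (coeff_mat p $$ ij))))"
    using mat_op_sum[OF n, of ?B "\<lambda>p ij. ?m p * const (coeff_mat p $$ ij)"] by simp
  also have "\<dots> = (\<Sum>p\<in>?B. op_scalar (?m p) * coeff_op p)"
  proof (rule sum.cong[OF refl])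
    fix p
    have "mat n n (\<lambda>ij. ?m p * const (coeff_mat p $$ ij)) = ?m p \<cdot>\<^sub>m map_mat const (coeff_mat p)"
      by (rule eq_matI) (auto simp: coeff_mat_def)
    then show "mat_op n (mat n n (\<lambda>ij. ?m p * const (coeff_mat p $$ ij))) = op_scalar (?m p) * coeff_op p"
      by (simp only: mat_op_smult[OF n] map_carrier_mat coeff_mat_carrier coeff_op_def const_op_def)
  qed
  also have "\<dots> = (\<Sum>(b, a, c)\<in>?B. op_scalar (yvar ^ b) * coeff_op (0, b, 0) *
      (op_scalar (xvar ^ a) * coeff_op (a, 0, 0)) * (op_scalar (zvar ^ c) * coeff_op (0, 0, c)))"
  proof (rule sum.reindex_bij_witness[of _ "\<lambda>(b, a, c). (a, b, c)" "\<lambda>(a, b, c). (b, a, c)"])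
    fix p :: mon
    obtain a b c where p: "p = (a, b, c)" by (cases p)
    show "(case (case p of (a, b, c) \<Rightarrow> (b, a, c)) of (b, a, c) \<Rightarrow>
        op_scalar (yvar ^ b) * coeff_op (0, b, 0) * (op_scalar (xvar ^ a) * coeff_op (a, 0, 0)) *
        (op_scalar (zvar ^ c) * coeff_op (0, 0, c))) = op_scalar (?m p) * coeff_op p"
      unfolding p prod.case scaled_mult monomial_eq coeff_op_factor[OF n, symmetric] ..
  qed auto
  also have "\<dots> = coord_sum (\<lambda>a. coeff_op (a, 0, 0)) (\<lambda>b. coeff_op (0, b, 0))
    (\<lambda>c. coeff_op (0, 0, c)) L xvar yvar zvar"
  proof -
    have "sum f R * sum g S * sum h T = (\<Sum>(b, a, c)\<in>R \<times> S \<times> T. f b * g a * h c)"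
      for f g h :: "nat \<Rightarrow> 'a coord_ring lin_op" and R S T
    proof -
      have "sum f R * sum g S * sum h T = (\<Sum>b\<in>R. \<Sum>a\<in>S. \<Sum>c\<in>T. f b * g a * h c)"
        unfolding sum_product[of f R g S] unfolding sum_distrib_right unfolding sum_distrib_left ..
      then show ?thesis by (simp add: sum.cartesian_product split_def)
    qed
    note distrib = this
    show ?thesis unfolding coord_sum_def distrib ..
  qed
  finally show ?thesis .
qed

lemma matrix_formula_char_0:
  assumes "CHAR('a) = 0"
  shows "\<exists>X Y Z. heisenberg_triple n X Y Z \<and> A = heisenberg_exp n xvar yvar zvar X Y Z"
proof -
  obtain D where D: "\<And>a b c i j. a \<ge> D \<or> b \<ge> D \<or> c \<ge> D \<Longrightarrow> i < n \<Longrightarrow> j < n \<Longrightarrow> coeff (a, b, c) i j = 0"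
    using coeff_bounded by blast
  \<comment> \<open>\<open>L\<close> exceeds all exponents that occur and is at least
    \<open>n\<close>, so sums up to \<open>L\<close> can be shortened to \<open>n\<close>. In
    characteristic zero \<open>q\<close> is free; \<open>4 * L\<close> covers all factorials
    needed.\<close>
  define L where "L = max D n"
  define q where "q = 4 * L"
  let ?\<phi> = "\<lambda>k. const (1 / of_nat (fact k)) :: 'a coord_ring"
  have es: "exp_scalars op_scalar ?\<phi> q"
    by (rule exp_scalars_op_scalar) (simp add: of_nat_eq_0_iff_char_dvd assms)
  interpret exp_scalars op_scalar ?\<phi> q by fact
  interpret heisenberg_seq n "\<lambda>a. coeff_op (a, 0, 0)" "\<lambda>b. coeff_op (0, b, 0)" "\<lambda>c. coeff_op (0, 0, c)"
    by (rule heisenberg_seq_coeff_op[OF n])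
  have pos: "0 < (1::nat)" by simp
  have nq: "4 * n \<le> q" by (simp add: q_def L_def)
  \<comment> \<open>Below \<open>L\<close> all factorials are invertible, so \<open>f k\<close> is a
    divided power of \<open>f 1\<close>; this vanishes from degree \<open>n\<close> on.\<close>
  have sum: "(\<Sum>k<L. op_scalar (u ^ k) * f k) = (\<Sum>k<n. divided_power (op_scalar u * f 1) k)"
    if "f 0 = 1" "\<And>i j. f i * f j = of_nat ((i + j) choose i) * f (i + j)" "f 1 ^ n = 0"
    for u and f :: "nat \<Rightarrow> 'a coord_ring lin_op"
  proof -
    have "(\<Sum>k<L. op_scalar (u ^ k) * f k) = (\<Sum>k<L. divided_power (op_scalar u * f 1) k)"
    proof (rule sum.cong[OF refl])
      fix k assume "k \<in> {..<L}"
      then have "k < q" by (simp add: q_def)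
      then have "f k = divided_power (f 1) k"
        by (rule divided_powerI) (rule divided_sequence_power[OF that(1,2), symmetric])
      then show "op_scalar (u ^ k) * f k = divided_power (op_scalar u * f 1) k"
        by (simp only: divided_power_scaled)
    qed
    also have "\<dots> = (\<Sum>k<n. divided_power (op_scalar u * f 1) k)"
    proof (rule sum.mono_neutral_right)
      have "(op_scalar u * f 1) ^ n = 0" by (simp only: scaled_power that(3) mult_zero_right)
      then show "\<forall>i\<in>{..<L} - {..<n}. divided_power (op_scalar u * f 1) i = 0"
        by (auto intro: divided_power_eq_0 simp del: One_nat_def)
    qed (auto simp: L_def)
    finally show ?thesis .
  qed
  define X Y Z where "X = coeff_mat (1, 0, 0)" and "Y = coeff_mat (0, 1, 0)" and "Z = coeff_mat (0, 0, 1)"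
  have ops: "const_op n X = coeff_op (1, 0, 0)" "const_op n Y = coeff_op (0, 1, 0)" "const_op n Z = coeff_op (0, 0, 1)"
    by (simp_all add: X_def Y_def Z_def coeff_op_def)
  have c: "X \<in> carrier_mat n n" "Y \<in> carrier_mat n n" "Z \<in> carrier_mat n n"
    by (simp_all add: X_def Y_def Z_def)
  have nil: "const_op n X ^ n = 0" "const_op n Y ^ n = 0" "const_op n Z ^ n = 0"
    unfolding ops by (rule nilpotent, simp)+
  have comm: "const_op n X * const_op n Y = const_op n Y * const_op n X + const_op n Z"
      "const_op n Z * const_op n X = const_op n X * const_op n Z"
      "const_op n Z * const_op n Y = const_op n Y * const_op n Z"
    unfolding ops by (rule commutator_1 central)+
  have E: "exp_sum n xvar yvar zvar (const_op n X) (const_op n Y) (const_op n Z) =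
      (\<Sum>k<n. divided_power (op_scalar yvar * const_op n Y) k) *
      (\<Sum>k<n. divided_power (op_scalar xvar * const_op n X) k) *
      (\<Sum>k<n. divided_power (op_scalar zvar * const_op n Z) k)"
    unfolding exp_sum_def by (rule exp_heisenberg(2)[OF comm nil nq n])
  have "mat_op n A = coord_sum (\<lambda>a. coeff_op (a, 0, 0)) (\<lambda>b. coeff_op (0, b, 0))
    (\<lambda>c. coeff_op (0, 0, c)) L xvar yvar zvar"
    by (rule mat_op_matrix[OF es]) (use D in \<open>auto simp: L_def\<close>)
  also have "\<dots> = exp_sum n xvar yvar zvar (const_op n X) (const_op n Y) (const_op n Z)"
    unfolding ops coord_sum_def E[unfolded ops]
      sum[of "\<lambda>a. coeff_op (a, 0, 0)", OF zeroth(1) divided(1) nilpotent(1)[OF pos]]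
      sum[of "\<lambda>b. coeff_op (0, b, 0)", OF zeroth(2) divided(2) nilpotent(2)[OF pos]]
      sum[of "\<lambda>c. coeff_op (0, 0, c)", OF zeroth(3) divided(3) nilpotent(3)[OF pos]] ..
  also have "\<dots> = mat_op n (heisenberg_exp n xvar yvar zvar X Y Z)"
    by (rule mat_op_heisenberg_exp[OF n c nil comm es nq, symmetric])
  finally have "mat_op n A = mat_op n (heisenberg_exp n xvar yvar zvar X Y Z)" .
  moreover have "A \<in> carrier_mat n n" using formula by (simp add: matrix_formula_def)
  moreover have "heisenberg_exp n xvar yvar zvar X Y Z \<in> carrier_mat n n"
    by (simp add: heisenberg_exp_def mat_exp_def)
  ultimately have "A = heisenberg_exp n xvar yvar zvar X Y Z" using mat_op_inject[OF n] by blast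
  then show ?thesis using heisenberg_tripleI[OF n c nil comm] by blast
qed

lemma matrix_formula_char_pos:
  assumes char: "CHAR('a) = p" and p: "p > 0" "p \<ge> 4 * n"
  shows "\<exists>(m::nat) X Y Z.
    (\<forall>i\<le>m. heisenberg_triple n (X i) (Y i) (Z i)) \<and>
    (\<forall>i\<le>m. \<forall>j\<le>m. i \<noteq> j \<longrightarrow> (\<forall>M\<in>{X i, Y i, Z i}. \<forall>N\<in>{X j, Y j, Z j}. M * N = N * M)) \<and>
    A = ordered_prod_mat n m (\<lambda>i.
      heisenberg_exp n (xvar ^ p ^ i) (yvar ^ p ^ i) (zvar ^ p ^ i) (X i) (Y i) (Z i))"
proof -
  obtain D where D: "\<And>a b c i j. a \<ge> D \<or> b \<ge> D \<or> c \<ge> D \<Longrightarrow> i < n \<Longrightarrow> j < n \<Longrightarrow> coeff (a, b, c) i j = 0"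
    using coeff_bounded by blast
  have prime: "prime p" using prime_CHAR_semidom[where 'a='a] char p by simp
  let ?\<phi> = "\<lambda>k. const (1 / of_nat (fact k)) :: 'a coord_ring"
  let ?xs = "\<lambda>a. coeff_op (a, 0, 0)" and ?ys = "\<lambda>b. coeff_op (0, b, 0)" and ?zs = "\<lambda>c. coeff_op (0, 0, c)"
  \<comment> \<open>The prime \<open>p\<close> does not divide \<open>k!\<close> for
    \<open>k < p\<close>.\<close>
  have es: "exp_scalars op_scalar ?\<phi> p"
    by (rule exp_scalars_op_scalar)
      (simp add: of_nat_eq_0_iff_char_dvd char prime_dvd_fact_iff[OF prime] del: of_nat_fact)
  interpret exp_scalars op_scalar ?\<phi> p by fact
  have "of_nat p = (0 :: 'a)" using char of_nat_CHAR[where 'a='a] by simp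
  then have "of_nat p = (0 :: 'a coord_ring)" by (metis single_of_nat single_zero)
  then have p0: "of_nat p = (0 :: 'a coord_ring lin_op)"
    by (metis scalar_of_nat scalar_0)
  interpret heisenberg_seq n ?xs ?ys ?zs
    by (rule heisenberg_seq_coeff_op[OF n])
  have hc: "heisenberg_char n ?xs ?ys ?zs op_scalar ?\<phi> p"
    by unfold_locales (use prime p0 p n in auto)
  interpret heisenberg_char n ?xs ?ys ?zs op_scalar ?\<phi> p by fact
  define X Y Z where "X i = coeff_mat (p ^ i, 0, 0)" and "Y i = coeff_mat (0, p ^ i, 0)"
    and "Z i = coeff_mat (0, 0, p ^ i)" for i
  have ops: "const_op n (X i) = ?xs (p ^ i)" "const_op n (Y i) = ?ys (p ^ i)" "const_op n (Z i) = ?zs (p ^ i)" for i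
    by (simp_all add: X_def Y_def Z_def coeff_op_def)
  have c: "X i \<in> carrier_mat n n" "Y i \<in> carrier_mat n n" "Z i \<in> carrier_mat n n" for i
    by (simp_all add: X_def Y_def Z_def)
  have nil: "const_op n (X i) ^ n = 0" "const_op n (Y i) ^ n = 0" "const_op n (Z i) ^ n = 0" for i
    unfolding ops using p by (intro nilpotent, simp)+
  have comm: "const_op n (X i) * const_op n (Y i) = const_op n (Y i) * const_op n (X i) + const_op n (Z i)"
      "const_op n (Z i) * const_op n (X i) = const_op n (X i) * const_op n (Z i)"
      "const_op n (Z i) * const_op n (Y i) = const_op n (Y i) * const_op n (Z i)" for i
    unfolding ops by (rule heisenberg_char_commutator[OF hc] central)+
  let ?F = "\<lambda>i. heisenberg_exp n (xvar ^ p ^ i) (yvar ^ p ^ i) (zvar ^ p ^ i) (X i) (Y i) (Z i)"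
  have F: "?F i \<in> carrier_mat n n" for i by (simp add: heisenberg_exp_def mat_exp_def)
  \<comment> \<open>The cutoff \<open>p ^ Suc D\<close> lies beyond all exponents that occur, and
    its form makes the factors run over \<open>i = 0, ..., D\<close>; thus
    \<open>m = D\<close>.\<close>
  have "D < p ^ D" using prime_gt_1_nat[OF prime] by (intro power_gt_expt) simp
  also have "p ^ D \<le> p ^ Suc D" using p by (intro power_increasing) auto
  finally have DL: "D \<le> p ^ Suc D" by simp
  have "mat_op n A = coord_sum ?xs ?ys ?zs (p ^ Suc D) xvar yvar zvar"
    by (rule mat_op_matrix[OF es]) (use D DL in \<open>auto simp del: power_Suc\<close>)
  also have "\<dots> = foldr (\<lambda>i B. exp_sum n (xvar ^ p ^ i) (yvar ^ p ^ i) (zvar ^ p ^ i)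
      (const_op n (X i)) (const_op n (Y i)) (const_op n (Z i)) * B) [0..<Suc D] 1"
    unfolding ops by (rule coord_sum_eq_exp_prod[OF hc])
  also have "\<dots> = foldr (\<lambda>i B. mat_op n (?F i) * B) [0..<Suc D] 1"
    unfolding mat_op_heisenberg_exp[OF n c nil comm es p(2)] ..
  also have "\<dots> = mat_op n (ordered_prod_mat n D ?F)"
    unfolding ordered_prod_mat_def by (rule mat_op_foldr(2)[OF n F, symmetric])
  finally have "mat_op n A = mat_op n (ordered_prod_mat n D ?F)" .
  moreover have "A \<in> carrier_mat n n" using formula by (simp add: matrix_formula_def)
  moreover have "ordered_prod_mat n D ?F \<in> carrier_mat n n"
    unfolding ordered_prod_mat_def by (rule mat_op_foldr(1)[OF n F])
  ultimately have A: "A = ordered_prod_mat n D ?F" using mat_op_inject[OF n] by blast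
  have xx: "?xs a * ?xs b = ?xs b * ?xs a" and yy: "?ys a * ?ys b = ?ys b * ?ys a"
    and zz: "?zs a * ?zs b = ?zs b * ?zs a" for a b
    by (rule divided_sequence_commute, rule divided)+
  have "M * N = N * M" if "i \<noteq> j" and M: "M \<in> {X i, Y i, Z i}" and N: "N \<in> {X j, Y j, Z j}" for i j M N
  proof -
    note xy = heisenberg_char_commute[OF hc \<open>i \<noteq> j\<close>]
      heisenberg_char_commute[OF hc \<open>i \<noteq> j\<close>[symmetric], symmetric]
    \<comment> \<open>Elements of the same sequence always commute, pairs with a \<open>zs\<close>
      do so by centrality, and only \<open>xs\<close> against \<open>ys\<close> requires
      \<open>i \<noteq> j\<close>.\<close>
    have "\<forall>P\<in>{?xs (p ^ i), ?ys (p ^ i), ?zs (p ^ i)}. \<forall>Q\<in>{?xs (p ^ j), ?ys (p ^ j), ?zs (p ^ j)}. P * Q = Q * P"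
      unfolding ball_simps
      by (intro conjI TrueI; rule xx yy zz xy central central[symmetric])
    then have "const_op n M * const_op n N = const_op n N * const_op n M"
      using M N ops by auto
    moreover have "M \<in> carrier_mat n n" "N \<in> carrier_mat n n" using M N c by auto
    ultimately show ?thesis
      by (intro const_op_inject[OF n]) (simp_all add: const_op_mult[OF n] mult_carrier_mat[of _ n n])
  qed
  moreover have "heisenberg_triple n (X i) (Y i) (Z i)" for i
    by (rule heisenberg_tripleI[OF n c nil comm])
  ultimately show ?thesis using A by blast
qed

end

end

theorem theorem1p4p2:
  fixes scale :: "'a::field \<Rightarrow> 'v::ab_group_add \<Rightarrow> 'v"
    and \<rho> :: "'v \<Rightarrow> (mon \<Rightarrow>\<^sub>0 'v)"
    and n :: nat
    and e :: "nat \<Rightarrow> 'v"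
    and A :: "'a coord_ring mat"
  assumes "vector_space scale"
    and "heisenberg_rep scale \<rho>"
    and "ordered_basis scale n e"
    and "matrix_formula scale n e \<rho> A"
  shows "(CHAR('a) = 0 \<longrightarrow>
           (\<exists>X Y Z. heisenberg_triple n X Y Z \<and>
              A = heisenberg_exp n xvar yvar zvar X Y Z)) \<and>
         (\<forall>p. CHAR('a) = p \<and> p > 0 \<and> p \<ge> char_bound n \<longrightarrow>
           (\<exists>(m::nat) X Y Z.
              (\<forall>i\<le>m. heisenberg_triple n (X i) (Y i) (Z i)) \<and>
              (\<forall>i\<le>m. \<forall>j\<le>m. i \<noteq> j \<longrightarrow>
                 (\<forall>M\<in>{X i, Y i, Z i}. \<forall>N\<in>{X j, Y j, Z j}. M * N = N * M)) \<and>
              A = ordered_prod_mat n m (\<lambda>i.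
                    heisenberg_exp n (xvar ^ p ^ i) (yvar ^ p ^ i) (zvar ^ p ^ i)
                      (X i) (Y i) (Z i))))"
proof -
  interpret heisenberg_matrix_rep scale \<rho> n e A
    using assms by (simp add: heisenberg_matrix_rep_def heisenberg_matrix_rep_axioms_def)
  show ?thesis
  proof (cases "n = 0")
    \<comment> \<open>For \<open>n = 0\<close> the map \<open>mat_op\<close> is zero and not unital,
      so this case is separate: any two empty matrices are equal, and zero matrices serve as
      witnesses.\<close>
    case True
    have A: "A \<in> carrier_mat 0 0" using formula True by (simp add: matrix_formula_def)
    have eq: "M = N" if "M \<in> carrier_mat 0 0" "N \<in> carrier_mat 0 0" for M N :: "'b mat"
      using that by (intro eq_matI) auto
    define N0 where "N0 = (0\<^sub>m 0 0 :: 'a mat)"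
    have triple: "heisenberg_triple 0 N0 N0 N0"
      unfolding heisenberg_triple_def nilpotent_mat_def commutator_mat_def N0_def
      by (auto intro!: eq exI[of _ 0])
    have F: "heisenberg_exp 0 u v w N0 N0 N0 \<in> carrier_mat 0 0" for u v w
      by (simp add: heisenberg_exp_def mat_exp_def)
    then have P: "ordered_prod_mat 0 0 (\<lambda>i. heisenberg_exp 0 (u i) (v i) (w i) N0 N0 N0) \<in> carrier_mat 0 0" for u v w
      by (simp add: ordered_prod_mat_def mult_carrier_mat[of _ 0 0])
    have "\<exists>X Y Z. heisenberg_triple 0 X Y Z \<and> A = heisenberg_exp 0 xvar yvar zvar X Y Z"
      using triple eq[OF A F] by blast
    moreover have "\<exists>(m::nat) X Y Z.
              (\<forall>i\<le>m. heisenberg_triple 0 (X i) (Y i) (Z i)) \<and>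
              (\<forall>i\<le>m. \<forall>j\<le>m. i \<noteq> j \<longrightarrow>
                 (\<forall>M\<in>{X i, Y i, Z i}. \<forall>N\<in>{X j, Y j, Z j}. M * N = N * M)) \<and>
              A = ordered_prod_mat 0 m (\<lambda>i.
                    heisenberg_exp 0 (xvar ^ p ^ i) (yvar ^ p ^ i) (zvar ^ p ^ i)
                      (X i) (Y i) (Z i))" for p
      by (rule exI[of _ 0], (rule exI[of _ "\<lambda>_. N0"])+) (use triple eq[OF A P] in auto)
    ultimately show ?thesis unfolding True by blast
  next
    case False
    then show ?thesis using matrix_formula_char_0 matrix_formula_char_pos by (simp add: char_bound_def)
  qed
qed

end
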